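(* Let $P$ be a finite poset that is decomposed into two disjoint chains $C_p:a_1<\cdots<a_p$ and $C_q:b_1<\cdots<b_q$ with $p,q\ge1$ (elements of different chains may be comparable). Let $\mathcal{A}$, $K[\mathbf{x}]$, the ideal $J$ and the monomial order $<_{\rm rev}$ be as defined in the context. Let $\mathcal{S}$ be the set of square-free monomials $x_{i_1,j_1}x_{i_2,j_2}\cdots x_{i_r,j_r}$ of $K[\mathbf{x}]$, $r=0,1,2,\ldots$, with each $(i_k,j_k)\in\mathcal{A}\setminus\big(\{(i,j_i^\sharp):0\le i\le p\}\cup\{(i_j^\flat,j):0\le j\le q\}\big)$ and $$0<i_1<i_2<\cdots<i_r\le p,\qquad 0<j_1<j_2<\cdots<j_r\le q .$$ Then the set of standard monomials of $\mathrm{in}_{<_{\rm rev}}(J)$ (the monomials of $K[\mathbf{x}]$ not belonging to $\mathrm{in}_{<_{\rm rev}}(J)$) is equal to $\mathcal{S}$.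
   Context: A poset ideal of $P$ is a subset $\alpha\subseteq P$ such that $a\in\alpha$, $b\in P$, $b\le a$ imply $b\in\alpha$. $\mathcal{A}$ is the set of pairs $(i,j)$, $0\le i\le p$, $0\le j\le q$, such that $\alpha_{i,j}=\{a_1,\ldots,a_i,b_1,\ldots,b_j\}$ is a poset ideal of $P$. $K=\mathbf{C}(\{\xi_{i,j}\}_{(i,j)\in\mathcal{A}})$ is the rational function field in the indeterminates $\xi_{i,j}$. $K[\mathbf{x}]=K[\{x_{i,j}\}_{(i,j)\in\mathcal{A}}]$ is a polynomial ring. Elements $\eta_{i*}$ ($0\le i\le p$) and $\eta_{*j}$ ($0\le j\le q$) of $K$ are given with $\eta_{0*}=\eta_{*0}$. Set $$\theta_{i*}=\sum_{(k,j)\in\mathcal{A},\,k\ge i}\xi_{k,j}x_{k,j}-\eta_{i*},\qquad \theta_{*j}=\sum_{(i,\ell)\in\mathcal{A},\,\ell\ge j}\xi_{i,\ell}x_{i,\ell}-\eta_{*j}.$$ $I_{\mathcal{O}(P)}$ is the toric ideal of the order polytope of $P$; its initial ideal is $$\mathrm{in}_{<_{\rm rev}}(I_{\mathcal{O}(P)})=(x_{i,j}x_{k,\ell}: i<k,\ \ell<j,\ (i,j),(k,\ell)\in\mathcal{A}).$$ $J$ is the ideal of $K[\mathbf{x}]$ generated by $\mathrm{in}_{<_{\rm rev}}(I_{\mathcal{O}(P)})$, all $\theta_{i*}$ ($0\le i\le p$) and all $\theta_{*j}$ ($0\le j\le q$). $<_{\rm rev}$ is the (graded) reverse lexicographic order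 on $K[\mathbf{x}]$ induced by the ordering of variables: $x_{i,j}>x_{k,\ell}$ if either $i+j<k+\ell$, or $i+j=k+\ell$ and $i>k$. For $0\le i\le p$, $j_i^\sharp$ is the smallest integer with $(i,j_i^\sharp)\in\mathcal{A}$. For $0\le j\le q$, $i_j^\flat$ is the smallest integer with $(i_j^\flat,j)\in\mathcal{A}$. *)

theory Defs
  imports
    Complex_Main
    "HOL-Library.Poly_Mapping"
    "HOL-Library.Product_Lexorder"
    "HOL-Computational_Algebra.Fraction_Field"
begin

text \<open>
  A monomial is an exponent vector of type \<^typ>\<open>'v \<Rightarrow>\<^sub>0 nat\<close>, and a polynomial maps
  monomials to coefficients.  Polynomial rings in the variables from a set \<open>V\<close> with coefficients
  from a subring \<open>C\<close> are carriers inside the full type.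
\<close>

type_synonym ('v, 'c) mpoly = "('v \<Rightarrow>\<^sub>0 nat) \<Rightarrow>\<^sub>0 'c"

definition polys :: "'c::zero set \<Rightarrow> 'v set \<Rightarrow> ('v, 'c) mpoly set" where
  "polys C V = {f. (\<forall>m. Poly_Mapping.lookup f m \<in> C) \<and>
                   (\<forall>m\<in>Poly_Mapping.keys f. Poly_Mapping.keys m \<subseteq> V)}"

definition X :: "'v \<Rightarrow> ('v, 'c::comm_ring_1) mpoly" where
  "X v = Poly_Mapping.single (Poly_Mapping.single v 1) 1"

definition const :: "'c::zero \<Rightarrow> ('v, 'c) mpoly" where
  "const c = Poly_Mapping.single 0 c"

definition monomials :: "'v set \<Rightarrow> ('v, 'c::comm_ring_1) mpoly set" where
  "monomials V = {Poly_Mapping.single m 1 | m. Poly_Mapping.keys m \<subseteq> V}"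

definition ideal_in :: "'r::comm_ring_1 set \<Rightarrow> 'r set \<Rightarrow> 'r set" where
  "ideal_in R G = {\<Sum>g\<in>F. c g * g | F c. finite F \<and> F \<subseteq> G \<and> c ` F \<subseteq> R}"

definition subst :: "('v \<Rightarrow> ('w, 'c) mpoly) \<Rightarrow> ('v, 'c::comm_ring_1) mpoly \<Rightarrow> ('w, 'c) mpoly" where
  "subst \<phi> f = (\<Sum>m\<in>Poly_Mapping.keys f. const (Poly_Mapping.lookup f m) *
                  (\<Prod>v\<in>Poly_Mapping.keys m. \<phi> v ^ Poly_Mapping.lookup m v))"

text \<open>
  The rational functions over the complex numbers in all \<open>\<xi>\<^sub>i\<^sub>j\<close>; the field generated by the
  \<open>\<xi>\<^sub>i\<^sub>j\<close> with \<open>(i, j) \<in> A\<close> is a subfield of it.  The lexicographic order on pairs is used only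
  to see that the polynomials form an integral domain; it is unrelated to \<open>less_rev\<close> below.
\<close>

type_synonym ratfun = "(nat \<times> nat, complex) mpoly fract"

definition ratfun_field :: "(nat \<times> nat) set \<Rightarrow> ratfun set" where
  "ratfun_field A = {Fract f g | f g. f \<in> polys UNIV A \<and> g \<in> polys UNIV A \<and> g \<noteq> 0}"

definition \<xi> :: "nat \<times> nat \<Rightarrow> ratfun" where
  "\<xi> v = Fract (X v) 1"

definition Kx :: "(nat \<times> nat) set \<Rightarrow> (nat \<times> nat, ratfun) mpoly set" where
  "Kx A = polys (ratfun_field A) A"

fun var_less :: "nat \<times> nat \<Rightarrow> nat \<times> nat \<Rightarrow> bool" where
  "var_less (k, l) (i, j) \<longleftrightarrow> i + j < k + l \<or> (i + j = k + l \<and> i > k)"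

definition mdeg :: "('v \<Rightarrow>\<^sub>0 nat) \<Rightarrow> nat" where
  "mdeg m = (\<Sum>v\<in>Poly_Mapping.keys m. Poly_Mapping.lookup m v)"

text \<open>
  In equal degree, the smallest variable in which two monomials differ decides: the monomial
  with the higher power of it is the smaller one.
\<close>

definition less_rev :: "(nat \<times> nat \<Rightarrow>\<^sub>0 nat) \<Rightarrow> (nat \<times> nat \<Rightarrow>\<^sub>0 nat) \<Rightarrow> bool" where
  "less_rev m n \<longleftrightarrow> mdeg m < mdeg n \<or>
     (mdeg m = mdeg n \<and>
      (\<exists>v. Poly_Mapping.lookup n v < Poly_Mapping.lookup m v \<and>
           (\<forall>w. var_less w v \<longrightarrow> Poly_Mapping.lookup m w = Poly_Mapping.lookup n w)))"

definition is_initial :: "(nat \<times> nat \<Rightarrow>\<^sub>0 nat) \<Rightarrow> (nat \<times> nat, 'c::zero) mpoly \<Rightarrow> bool" where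
  "is_initial m f \<longleftrightarrow> m \<in> Poly_Mapping.keys f \<and>
     (\<forall>n\<in>Poly_Mapping.keys f. n \<noteq> m \<longrightarrow> less_rev n m)"

definition initial_ideal ::
  "(nat \<times> nat) set \<Rightarrow> (nat \<times> nat, ratfun) mpoly set \<Rightarrow> (nat \<times> nat, ratfun) mpoly set" where
  "initial_ideal A I =
     ideal_in (Kx A) {Poly_Mapping.single m 1 | m. \<exists>f\<in>I. f \<noteq> 0 \<and> is_initial m f}"

definition standard_monomials ::
  "(nat \<times> nat) set \<Rightarrow> (nat \<times> nat, ratfun) mpoly set \<Rightarrow> (nat \<times> nat, ratfun) mpoly set" where
  "standard_monomials A I = monomials A - initial_ideal A I"

definition poset_ideal :: "'a::order set \<Rightarrow> 'a set \<Rightarrow> bool" where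
  "poset_ideal P \<alpha> \<longleftrightarrow> \<alpha> \<subseteq> P \<and> (\<forall>x\<in>\<alpha>. \<forall>y\<in>P. y \<le> x \<longrightarrow> y \<in> \<alpha>)"

definition two_chain_poset ::
  "'a::order set \<Rightarrow> (nat \<Rightarrow> 'a) \<Rightarrow> (nat \<Rightarrow> 'a) \<Rightarrow> nat \<Rightarrow> nat \<Rightarrow> bool" where
  "two_chain_poset P a b p q \<longleftrightarrow>
     P = a ` {1..p} \<union> b ` {1..q} \<and> a ` {1..p} \<inter> b ` {1..q} = {} \<and>
     strict_mono_on {1..p} a \<and> strict_mono_on {1..q} b"

fun \<alpha> :: "(nat \<Rightarrow> 'a) \<Rightarrow> (nat \<Rightarrow> 'a) \<Rightarrow> nat \<times> nat \<Rightarrow> 'a set" where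
  "\<alpha> a b (i, j) = a ` {1..i} \<union> b ` {1..j}"

definition index_set ::
  "'a::order set \<Rightarrow> (nat \<Rightarrow> 'a) \<Rightarrow> (nat \<Rightarrow> 'a) \<Rightarrow> nat \<Rightarrow> nat \<Rightarrow> (nat \<times> nat) set" where
  "index_set P a b p q = {(i, j). i \<le> p \<and> j \<le> q \<and> poset_ideal P (\<alpha> a b (i, j))}"

text \<open>
  The vertices of the order polytope are the indicator vectors of the poset ideals, i.e. of the
  \<open>\<alpha>\<^sub>i\<^sub>j\<close> with \<open>(i, j) \<in> A\<close>.  Its toric ideal is the kernel of the map sending \<open>x\<^sub>i\<^sub>j\<close> to the
  homogenizing variable \<open>X None\<close> times the product of the variables \<open>X (Some c)\<close>, \<open>c \<in> \<alpha>\<^sub>i\<^sub>j\<close>.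
\<close>

definition toric_ideal ::
  "(nat \<times> nat) set \<Rightarrow> (nat \<Rightarrow> 'a) \<Rightarrow> (nat \<Rightarrow> 'a) \<Rightarrow> (nat \<times> nat, ratfun) mpoly set" where
  "toric_ideal A a b =
     {f \<in> Kx A. subst (\<lambda>v. X None * (\<Prod>c\<in>\<alpha> a b v. X (Some c))) f = 0}"

definition theta_row ::
  "(nat \<times> nat) set \<Rightarrow> (nat \<Rightarrow> ratfun) \<Rightarrow> nat \<Rightarrow> (nat \<times> nat, ratfun) mpoly" where
  "theta_row A \<eta> i = (\<Sum>(k, j)\<in>{(k, j)\<in>A. k \<ge> i}. const (\<xi> (k, j)) * X (k, j)) - const (\<eta> i)"

definition theta_col ::
  "(nat \<times> nat) set \<Rightarrow> (nat \<Rightarrow> ratfun) \<Rightarrow> nat \<Rightarrow> (nat \<times> nat, ratfun) mpoly" where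
  "theta_col A \<eta> j = (\<Sum>(i, l)\<in>{(i, l)\<in>A. l \<ge> j}. const (\<xi> (i, l)) * X (i, l)) - const (\<eta> j)"

definition J_ideal ::
  "(nat \<times> nat) set \<Rightarrow> (nat \<Rightarrow> 'a) \<Rightarrow> (nat \<Rightarrow> 'a) \<Rightarrow> nat \<Rightarrow> nat \<Rightarrow>
   (nat \<Rightarrow> ratfun) \<Rightarrow> (nat \<Rightarrow> ratfun) \<Rightarrow> (nat \<times> nat, ratfun) mpoly set" where
  "J_ideal A a b p q \<eta>r \<eta>c =
     ideal_in (Kx A)
       (initial_ideal A (toric_ideal A a b) \<union> theta_row A \<eta>r ` {0..p} \<union> theta_col A \<eta>c ` {0..q})"

definition j_sharp :: "(nat \<times> nat) set \<Rightarrow> nat \<Rightarrow> nat" where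
  "j_sharp A i = (LEAST j. (i, j) \<in> A)"

definition i_flat :: "(nat \<times> nat) set \<Rightarrow> nat \<Rightarrow> nat" where
  "i_flat A j = (LEAST i. (i, j) \<in> A)"

definition S_set :: "(nat \<times> nat) set \<Rightarrow> nat \<Rightarrow> nat \<Rightarrow> (nat \<times> nat, ratfun) mpoly set" where
  "S_set A p q =
     {\<Prod>k=1..r. X (i k, j k) | (r::nat) i j.
        (\<forall>k\<in>{1..r}. (i k, j k) \<in> A - ({(m, j_sharp A m) | m. m \<le> p} \<union> {(i_flat A m, m) | m. m \<le> q})
                   \<and> 0 < i k \<and> i k \<le> p \<and> 0 < j k \<and> j k \<le> q) \<and>
        strict_mono_on {1..r} i \<and> strict_mono_on {1..r} j}"

end

theory Submission
  imports
    Defs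
    "HOL-Computational_Algebra.Polynomial_Factorial"
    "HOL-Library.Function_Algebras"
begin

text \<open>
  Modulo \<open>J\<close> every monomial outside the set is a combination of smaller ones: differences of
  consecutive \<open>\<theta>\<close> are the linear forms of single rows and columns, and a variable times such a form,
  up to antidiagonal products, is a relation with leading monomial a product of two variables in the
  same row or column.  For the converse one counts.  The facets of the
  simplicial complex of antidiagonal products are the maximal lattice paths in \<open>A\<close>, and along a path
  the system \<open>\<theta> = 0\<close> is triangular.  After a generic perturbation \<open>\<eta> + \<epsilon> w\<close> of the right-hand side it
  has one solution for each path, and these solutions have distinct supports, so that evaluation
  at them maps the polynomial ring onto a space of dimension the number of paths.  The standard monomials
  span this space over the polynomials in \<open>\<epsilon>\<close>, and they are at most as many as the paths, hence they
  are independent.  An element of \<open>J\<close> with standard initial monomial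
  evaluates to a multiple of \<open>\<epsilon>\<close>, which contradicts its nonzero leading coefficient.
\<close>

text \<open>The values \<eta> are arbitrary, so the path solutions at \<eta> itself may coincide or
  have zero coordinates; for \<eta> = 0 all of them are the origin. The perturbation repairs this,
  and \<epsilon> stays an indeterminate because \<epsilon> = 0 must remain visible: it is where the
  \<theta> in J live. The price is that coefficients now lie in K[\<epsilon>], which is not a field.
  The reduction survives because its leading coefficients are powers of some \<open>\<xi> v\<close>,
  units both in K and in K[\<epsilon>]. It is therefore proved for an abstract coefficient ring and
  ideal and used twice: for J over K, and for the polynomials over K[\<epsilon>] that vanish at all
  path solutions. The final contradiction uses more than divisibility of values. The value of a
  member of J is \<epsilon> times the value of another polynomial, and both values expand in
  standard monomials over K[\<epsilon>]. Independence then makes each coefficient of the first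
  expansion divisible by \<epsilon>, whereas the one at a standard initial monomial is the leading
  coefficient, a nonzero constant.\<close>

abbreviation "lookup \<equiv> Poly_Mapping.lookup"
abbreviation "keys \<equiv> Poly_Mapping.keys"
abbreviation "single \<equiv> Poly_Mapping.single"

section \<open>Evaluation of polynomials\<close>

lemma poly_mapping_eq_sum_single: "f = (\<Sum>m\<in>keys f. single m (lookup f m))"
proof (rule poly_mapping_eqI)
  fix k
  show "lookup f k = lookup (\<Sum>m\<in>keys f. single m (lookup f m)) k"
    by (cases "k \<in> keys f")
      (auto simp: lookup_sum lookup_single when_def in_keys_iff sum.delta)
qed

lemma keys_add_nat: "keys (m + n :: 'v \<Rightarrow>\<^sub>0 nat) = keys m \<union> keys n"
  by (auto simp: in_keys_iff lookup_add)

lemma keys_diff_subset: "keys (f - g :: 'v \<Rightarrow>\<^sub>0 'c::ab_group_add) \<subseteq> keys f \<union> keys g"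
  by (auto simp: in_keys_iff lookup_minus)

lemma keys_sum_subset: "keys (sum f S :: 'v \<Rightarrow>\<^sub>0 'c::comm_monoid_add) \<subseteq> (\<Union>x\<in>S. keys (f x))"
  by (auto simp: in_keys_iff lookup_sum elim!: sum.not_neutral_contains_not_neutral)

definition meval :: "('v \<Rightarrow> 'r::comm_ring_1) \<Rightarrow> ('v \<Rightarrow>\<^sub>0 nat) \<Rightarrow> 'r" where
  "meval z m = (\<Prod>v\<in>keys m. z v ^ lookup m v)"

lemma meval_superset:
  assumes "finite V" "keys m \<subseteq> V"
  shows "meval z m = (\<Prod>v\<in>V. z v ^ lookup m v)"
  unfolding meval_def using assms
  by (intro prod.mono_neutral_left) (auto simp: in_keys_iff)

lemma meval_add: "meval z (m + n) = meval z m * meval z n"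
proof -
  let ?V = "keys m \<union> keys n"
  have "meval z (m + n) = (\<Prod>v\<in>?V. z v ^ lookup (m + n) v)"
    by (rule meval_superset) (auto simp: keys_add_nat)
  also have "\<dots> = (\<Prod>v\<in>?V. z v ^ lookup m v) * (\<Prod>v\<in>?V. z v ^ lookup n v)"
    by (simp add: lookup_add power_add prod.distrib)
  also have "\<dots> = meval z m * meval z n"
    by (subst (1 2) meval_superset[of ?V]) auto
  finally show ?thesis .
qed

lemma meval_zero [simp]: "meval z 0 = 1"
  by (simp add: meval_def)

lemma meval_single [simp]: "meval z (single v k) = z v ^ k"
  by (cases "k = 0") (auto simp: meval_def)

lemma meval_sum: "meval z (sum f S) = (\<Prod>x\<in>S. meval z (f x))"
  by (induction S rule: infinite_finite_induct) (auto simp: meval_add)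

lemma meval_eq_0:
  assumes "v \<in> keys m" "z v = 0"
  shows "meval z m = 0"
  unfolding meval_def
  by (rule prod_zero, simp, rule bexI[of _ v]) (use assms in \<open>auto simp: in_keys_iff power_0_left\<close>)

text \<open>The coefficient map is a parameter because three are needed: \<open>const\<close> for
  the toric substitution, \<open>[:c:]\<close> for values in K[\<epsilon>] of polynomials over K,
  and the identity for polynomials over K[\<epsilon>].\<close>

definition peval :: "('c::comm_ring_1 \<Rightarrow> 'r::comm_ring_1) \<Rightarrow> ('v \<Rightarrow> 'r) \<Rightarrow> ('v, 'c) mpoly \<Rightarrow> 'r" where
  "peval h z f = (\<Sum>m\<in>keys f. h (lookup f m) * meval z m)"

locale coeff_hom =
  fixes h :: "'c::comm_ring_1 \<Rightarrow> 'r::comm_ring_1"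
  assumes hom_add: "h (x + y) = h x + h y"
    and hom_mult: "h (x * y) = h x * h y"
    and hom_one: "h 1 = 1"
begin

lemma hom_zero: "h 0 = 0"
  using hom_add[of 0 0] by simp

lemma peval_superset:
  assumes "finite M" "keys f \<subseteq> M"
  shows "peval h z f = (\<Sum>m\<in>M. h (lookup f m) * meval z m)"
  unfolding peval_def using assms
  by (intro sum.mono_neutral_left) (auto simp: in_keys_iff hom_zero)

lemma peval_zero [simp]: "peval h z 0 = 0"
  by (simp add: peval_def)

lemma peval_single: "peval h z (single m c) = h c * meval z m"
  by (cases "c = 0") (auto simp: peval_def hom_zero)

lemma peval_add: "peval h z (f + g) = peval h z f + peval h z g"
proof -
  let ?M = "keys f \<union> keys g"
  have "peval h z (f + g) = (\<Sum>m\<in>?M. h (lookup (f + g) m) * meval z m)"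
    using Poly_Mapping.keys_add[of f g] by (intro peval_superset) auto
  also have "\<dots> = (\<Sum>m\<in>?M. h (lookup f m) * meval z m) + (\<Sum>m\<in>?M. h (lookup g m) * meval z m)"
    by (simp add: lookup_add hom_add algebra_simps sum.distrib)
  also have "\<dots> = peval h z f + peval h z g"
    by (subst (1 2) peval_superset[of ?M]) auto
  finally show ?thesis .
qed

lemma peval_uminus: "peval h z (- f) = - peval h z f"
  using peval_add[of z f "- f"] by (simp add: eq_neg_iff_add_eq_0 add.commute)

lemma peval_diff: "peval h z (f - g) = peval h z f - peval h z g"
  using peval_add[of z f "- g"] by (simp add: peval_uminus)

lemma peval_sum: "peval h z (sum F S) = (\<Sum>x\<in>S. peval h z (F x))"
  by (induction S rule: infinite_finite_induct) (auto simp: peval_add)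

lemma peval_mult: "peval h z (f * g) = peval h z f * peval h z g"
proof -
  have "f * g = (\<Sum>m\<in>keys f. single m (lookup f m)) * (\<Sum>n\<in>keys g. single n (lookup g n))"
    using poly_mapping_eq_sum_single[of f] poly_mapping_eq_sum_single[of g] by simp
  also have "\<dots> = (\<Sum>m\<in>keys f. \<Sum>n\<in>keys g. single (m + n) (lookup f m * lookup g n))"
    by (simp add: sum_product mult_single)
  finally have "peval h z (f * g) = (\<Sum>m\<in>keys f. \<Sum>n\<in>keys g.
      (h (lookup f m) * meval z m) * (h (lookup g n) * meval z n))"
    by (simp add: peval_sum peval_single hom_mult meval_add mult_ac)
  also have "\<dots> = peval h z f * peval h z g"
    by (simp add: peval_def sum_product)
  finally show ?thesis .
qed

lemma peval_const [simp]: "peval h z (const c) = h c"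
  by (simp add: const_def peval_single)

lemma peval_X [simp]: "peval h z (X v) = z v"
  by (simp add: X_def peval_single hom_one)

end

lemma coeff_hom_id: "coeff_hom (\<lambda>x. x)"
  by unfold_locales auto

lemma coeff_hom_const: "coeff_hom const"
  by unfold_locales (auto simp: const_def single_add mult_single)

lemma coeff_hom_constant_poly: "coeff_hom (\<lambda>x. [:x:])"
  by unfold_locales auto

lemma subst_eq_peval: "subst \<phi> f = peval const \<phi> f"
  by (simp add: subst_def peval_def meval_def)

section \<open>Subrings, polynomial rings and ideals\<close>

definition is_subring :: "'c::comm_ring_1 set \<Rightarrow> bool" where
  "is_subring C \<longleftrightarrow> 0 \<in> C \<and> 1 \<in> C \<and> (\<forall>x\<in>C. \<forall>y\<in>C. x + y \<in> C \<and> x * y \<in> C) \<and> (\<forall>x\<in>C. - x \<in> C)"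

lemma is_subring_sum: "is_subring C \<Longrightarrow> (\<And>x. x \<in> S \<Longrightarrow> f x \<in> C) \<Longrightarrow> sum f S \<in> C"
  by (induction S rule: infinite_finite_induct) (auto simp: is_subring_def)

lemma is_subring_diff: "is_subring C \<Longrightarrow> x \<in> C \<Longrightarrow> y \<in> C \<Longrightarrow> x - y \<in> C"
  unfolding is_subring_def by (metis diff_conv_add_uminus)

lemma is_subring_UNIV: "is_subring UNIV"
  by (simp add: is_subring_def)

lemma single_in_polys: "0 \<in> C \<Longrightarrow> c \<in> C \<Longrightarrow> keys m \<subseteq> V \<Longrightarrow> single m c \<in> polys C V"
  by (auto simp: polys_def lookup_single when_def split: if_splits)

lemma const_in_polys: "is_subring C \<Longrightarrow> c \<in> C \<Longrightarrow> const c \<in> polys C V"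
  by (simp add: const_def single_in_polys is_subring_def)

lemma X_in_polys: "is_subring C \<Longrightarrow> v \<in> V \<Longrightarrow> X v \<in> polys C V"
  by (auto simp: X_def is_subring_def intro!: single_in_polys)

lemma is_subring_polys:
  assumes C: "is_subring C"
  shows "is_subring (polys C V)"
proof -
  have add: "f + g \<in> polys C V" if "f \<in> polys C V" "g \<in> polys C V" for f g
    using that C Poly_Mapping.keys_add[of f g] by (fastforce simp: polys_def lookup_add is_subring_def)
  have zero: "0 \<in> polys C V" and one: "1 \<in> polys C V" and minus: "- f \<in> polys C V" if "f \<in> polys C V" for f
    using that C single_in_polys[of C 1 0 V] by (auto simp: polys_def is_subring_def in_keys_iff)
  have sum: "sum F S \<in> polys C V" if "\<And>x. x \<in> S \<Longrightarrow> F x \<in> polys C V" for F and S :: "'x set"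
    using that
  proof (induction S rule: infinite_finite_induct)
    case (insert x S)
    then show ?case by (simp add: add)
  qed (use C in \<open>auto simp: polys_def is_subring_def\<close>)
  have mult: "f * g \<in> polys C V" if "f \<in> polys C V" "g \<in> polys C V" for f g
  proof -
    have "f * g = (\<Sum>m\<in>keys f. single m (lookup f m)) * (\<Sum>n\<in>keys g. single n (lookup g n))"
      using poly_mapping_eq_sum_single[of f] poly_mapping_eq_sum_single[of g] by simp
    also have "\<dots> = (\<Sum>m\<in>keys f. \<Sum>n\<in>keys g. single (m + n) (lookup f m * lookup g n))"
      by (simp add: sum_product mult_single)
    also have "\<dots> \<in> polys C V"
    proof (intro sum single_in_polys)
      show "0 \<in> C" using C by (simp add: is_subring_def)
    next
      fix m n assume *: "m \<in> keys f" "n \<in> keys g"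
      show "lookup f m * lookup g n \<in> C"
        using C that unfolding is_subring_def polys_def by blast
      show "keys (m + n) \<subseteq> V"
        using that * by (auto simp: polys_def keys_add_nat)
    qed
    finally show ?thesis .
  qed
  have "0 \<in> polys C V" "1 \<in> polys C V"
    using C single_in_polys[of C 1 0 V] by (auto simp: polys_def is_subring_def)
  with add mult minus show ?thesis
    by (auto simp: is_subring_def)
qed

text \<open>The properties of \<^const>\<open>ideal_in\<close> that the reduction argument uses; a common kernel of
  evaluations has them as well.\<close>

definition is_ideal :: "'r::comm_ring_1 set \<Rightarrow> 'r set \<Rightarrow> bool" where
  "is_ideal R I \<longleftrightarrow> 0 \<in> I \<and> (\<forall>x\<in>I. \<forall>y\<in>I. x + y \<in> I) \<and> (\<forall>r\<in>R. \<forall>x\<in>I. r * x \<in> I)"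

lemma (in coeff_hom) is_ideal_common_zeros: "is_ideal R {f. \<forall>r\<in>\<Phi>. peval h (z r) f = 0}"
  by (simp add: is_ideal_def peval_add peval_mult)

lemma is_ideal_sum: "is_ideal R I \<Longrightarrow> (\<And>x. x \<in> S \<Longrightarrow> f x \<in> I) \<Longrightarrow> sum f S \<in> I"
  by (induction S rule: infinite_finite_induct) (auto simp: is_ideal_def)

lemma is_ideal_diff:
  assumes "is_subring R" "is_ideal R I" "x \<in> I" "y \<in> I"
  shows "x - y \<in> I"
proof -
  have "(- 1) * y \<in> I"
    using assms unfolding is_ideal_def is_subring_def by blast
  then have "x + (- 1) * y \<in> I"
    using assms unfolding is_ideal_def by blast
  then show ?thesis by simp
qed

lemma ideal_inE:
  assumes "x \<in> ideal_in R G"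
  obtains F c where "x = (\<Sum>g\<in>F. c g * g)" "finite F" "F \<subseteq> G" "c ` F \<subseteq> R"
  using assms unfolding ideal_in_def by blast

lemma ideal_in_is_ideal:
  assumes R: "is_subring R"
  shows "is_ideal R (ideal_in R G)"
proof -
  have zero: "0 \<in> ideal_in R G"
    unfolding ideal_in_def by (rule CollectI, rule exI[of _ "{}"]) simp
  have add: "x + y \<in> ideal_in R G" if "x \<in> ideal_in R G" "y \<in> ideal_in R G" for x y
  proof -
    obtain F c where x: "x = (\<Sum>g\<in>F. c g * g)" "finite F" "F \<subseteq> G" "c ` F \<subseteq> R"
      using \<open>x \<in> ideal_in R G\<close> by (rule ideal_inE)
    obtain F' c' where y: "y = (\<Sum>g\<in>F'. c' g * g)" "finite F'" "F' \<subseteq> G" "c' ` F' \<subseteq> R"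
      using \<open>y \<in> ideal_in R G\<close> by (rule ideal_inE)
    define d where "d g = (if g \<in> F then c g else 0) + (if g \<in> F' then c' g else 0)" for g
    have "x = (\<Sum>g\<in>F \<union> F'. (if g \<in> F then c g else 0) * g)"
      unfolding x(1) by (rule sum.mono_neutral_cong_left) (use x y in auto)
    moreover have "y = (\<Sum>g\<in>F \<union> F'. (if g \<in> F' then c' g else 0) * g)"
      unfolding y(1) by (rule sum.mono_neutral_cong_left) (use x y in auto)
    ultimately have "x + y = (\<Sum>g\<in>F \<union> F'. d g * g)"
      by (simp add: d_def distrib_right sum.distrib)
    moreover have "d ` (F \<union> F') \<subseteq> R"
      using x(4) y(4) R by (auto simp: d_def is_subring_def image_subset_iff)
    ultimately show ?thesis
      unfolding ideal_in_def using x y by (intro CollectI exI[of _ "F \<union> F'"] exI[of _ d]) auto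
  qed
  have mult: "r * x \<in> ideal_in R G" if "r \<in> R" "x \<in> ideal_in R G" for r x
  proof -
    obtain F c where x: "x = (\<Sum>g\<in>F. c g * g)" "finite F" "F \<subseteq> G" "c ` F \<subseteq> R"
      using \<open>x \<in> ideal_in R G\<close> by (rule ideal_inE)
    show ?thesis
      unfolding ideal_in_def
      by (intro CollectI exI[of _ F] exI[of _ "\<lambda>g. r * c g"])
        (use x R that in \<open>auto simp: sum_distrib_left mult.assoc is_subring_def\<close>)
  qed
  show ?thesis
    using zero add mult by (auto simp: is_ideal_def)
qed

lemma ideal_in_generator: "is_subring R \<Longrightarrow> g \<in> G \<Longrightarrow> g \<in> ideal_in R G"
  unfolding ideal_in_def is_subring_def
  by (rule CollectI, rule exI[of _ "{g}"], rule exI[of _ "\<lambda>_. 1"]) auto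

lemma ideal_in_least:
  assumes "is_ideal R I" "G \<subseteq> I"
  shows "ideal_in R G \<subseteq> I"
proof
  fix x assume "x \<in> ideal_in R G"
  then obtain F c where x: "x = (\<Sum>g\<in>F. c g * g)" "finite F" "F \<subseteq> G" "c ` F \<subseteq> R"
    by (rule ideal_inE)
  have "c g * g \<in> I" if "g \<in> F" for g
    using x assms that unfolding is_ideal_def by blast
  then show "x \<in> I"
    unfolding x(1) by (rule is_ideal_sum[OF assms(1)])
qed

section \<open>The coefficient field generated by the \<xi>\<close>

lemma Fract_in_ratfun_field:
  "f \<in> polys UNIV A \<Longrightarrow> g \<in> polys UNIV A \<Longrightarrow> g \<noteq> 0 \<Longrightarrow> Fract f g \<in> ratfun_field A"
  by (auto simp: ratfun_field_def)

lemma is_subring_ratfun_field: "is_subring (ratfun_field A)"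
proof -
  have P: "is_subring (polys UNIV A :: (nat \<times> nat, complex) mpoly set)"
    by (intro is_subring_polys is_subring_UNIV)
  note P' = P[unfolded is_subring_def]
  have "0 \<in> ratfun_field A" "1 \<in> ratfun_field A"
    unfolding Zero_fract_def One_fract_def using P' by (auto intro!: Fract_in_ratfun_field)
  moreover have "x + y \<in> ratfun_field A \<and> x * y \<in> ratfun_field A"
    if "x \<in> ratfun_field A" "y \<in> ratfun_field A" for x y
  proof -
    obtain f g where x: "x = Fract f g" "f \<in> polys UNIV A" "g \<in> polys UNIV A" "g \<noteq> 0"
      using \<open>x \<in> _\<close> by (auto simp: ratfun_field_def)
    obtain f' g' where y: "y = Fract f' g'" "f' \<in> polys UNIV A" "g' \<in> polys UNIV A" "g' \<noteq> 0"
      using \<open>y \<in> _\<close> by (auto simp: ratfun_field_def)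
    show ?thesis
      using x y P' by (auto intro!: Fract_in_ratfun_field)
  qed
  moreover have "- x \<in> ratfun_field A" if "x \<in> ratfun_field A" for x
  proof -
    obtain f g where "x = Fract f g" "f \<in> polys UNIV A" "g \<in> polys UNIV A" "g \<noteq> 0"
      using \<open>x \<in> ratfun_field A\<close> unfolding ratfun_field_def by blast
    then show ?thesis
      using P' by (auto intro!: Fract_in_ratfun_field)
  qed
  ultimately show ?thesis
    by (auto simp: is_subring_def)
qed

lemma xi_in_ratfun_field: "v \<in> A \<Longrightarrow> \<xi> v \<in> ratfun_field A"
  unfolding \<xi>_def
  using is_subring_polys[OF is_subring_UNIV, of A, where 'a = complex]
  by (intro Fract_in_ratfun_field X_in_polys) (auto simp: is_subring_UNIV is_subring_def)

lemma xi_nonzero: "\<xi> v \<noteq> 0"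
proof -
  have "lookup (X v :: (nat \<times> nat, complex) mpoly) (single v 1) \<noteq> 0"
    by (simp add: X_def)
  then have "(X v :: (nat \<times> nat, complex) mpoly) \<noteq> 0"
    by (metis lookup_zero)
  then show ?thesis
    by (simp add: \<xi>_def Zero_fract_def eq_fract)
qed

lemma is_subring_Kx: "is_subring (Kx A)"
  by (simp add: Kx_def is_subring_polys is_subring_ratfun_field)

section \<open>The monomial order\<close>

lemma var_less_irrefl: "\<not> var_less v v"
  by (cases v) auto

lemma var_less_trans: "var_less u v \<Longrightarrow> var_less v w \<Longrightarrow> var_less u w"
  by (cases u; cases v; cases w) auto

lemma var_less_total: "v \<noteq> w \<Longrightarrow> var_less v w \<or> var_less w v"
  by (cases v; cases w) auto

lemma mdeg_superset: "finite V \<Longrightarrow> keys m \<subseteq> V \<Longrightarrow> mdeg m = (\<Sum>v\<in>V. lookup m v)"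
  unfolding mdeg_def by (intro sum.mono_neutral_left) (auto simp: in_keys_iff)

lemma mdeg_add: "mdeg (m + n) = mdeg m + mdeg n"
proof -
  let ?V = "keys m \<union> keys n"
  have "mdeg (m + n) = (\<Sum>v\<in>?V. lookup m v) + (\<Sum>v\<in>?V. lookup n v)"
    by (subst mdeg_superset[of ?V]) (auto simp: keys_add_nat lookup_add sum.distrib)
  also have "\<dots> = mdeg m + mdeg n"
    by (subst (1 2) mdeg_superset[of ?V]) auto
  finally show ?thesis .
qed

lemma mdeg_single [simp]: "mdeg (single v k) = k"
  by (cases "k = 0") (auto simp: mdeg_def)

lemma mdeg_zero [simp]: "mdeg 0 = 0"
  by (simp add: mdeg_def)

lemma less_rev_irrefl: "\<not> less_rev m m"
  by (auto simp: less_rev_def)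

lemma less_rev_trans:
  assumes "less_rev l m" "less_rev m n"
  shows "less_rev l n"
proof (cases "mdeg l = mdeg m \<and> mdeg m = mdeg n")
  case False
  then show ?thesis using assms by (auto simp: less_rev_def)
next
  case True
  obtain v where v: "lookup m v < lookup l v" "\<And>w. var_less w v \<Longrightarrow> lookup l w = lookup m w"
    using assms(1) True unfolding less_rev_def by (metis order.irrefl)
  obtain u where u: "lookup n u < lookup m u" "\<And>w. var_less w u \<Longrightarrow> lookup m w = lookup n w"
    using assms(2) True unfolding less_rev_def by (metis order.irrefl)
  consider "v = u" | "var_less v u" | "var_less u v"
    using var_less_total by blast
  then have "\<exists>v. lookup n v < lookup l v \<and> (\<forall>w. var_less w v \<longrightarrow> lookup l w = lookup n w)"
  proof cases
    case 1
    then show ?thesis using u v by (intro exI[of _ v]) auto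
  next
    case 2
    then have "lookup n v < lookup l v \<and> (\<forall>w. var_less w v \<longrightarrow> lookup l w = lookup n w)"
      using u(2)[of v] v var_less_trans[of _ v u] by (simp add: u(2))
    then show ?thesis by blast
  next
    case 3
    then have "lookup n u < lookup l u \<and> (\<forall>w. var_less w u \<longrightarrow> lookup l w = lookup n w)"
      using v(2)[of u] u var_less_trans[of _ u v] by (simp add: v(2))
    then show ?thesis by blast
  qed
  then show ?thesis using True by (simp add: less_rev_def)
qed

lemma less_rev_add: "less_rev m n \<Longrightarrow> less_rev (t + m) (t + n)"
  unfolding less_rev_def mdeg_add lookup_add by auto

lemma less_rev_degree: "mdeg m < mdeg n \<Longrightarrow> less_rev m n"
  by (simp add: less_rev_def)

text \<open>Below \<open>v\<close> both exponents are zero, so \<open>v\<close> is also the smallest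
  variable in which the monomials differ.\<close>

lemma less_rev_smallest_var:
  assumes "mdeg m = mdeg n" "v \<in> keys m" "v \<notin> keys n"
    and "\<And>w. w \<in> keys m \<union> keys n \<Longrightarrow> \<not> var_less w v"
  shows "less_rev m n"
proof -
  have "lookup m w = lookup n w" if "var_less w v" for w
    using assms(4)[of w] that by (metis UnCI in_keys_iff)
  then show ?thesis
    unfolding less_rev_def using assms(1-3) by (intro disjI2 conjI exI[of _ v]) (simp_all add: in_keys_iff)
qed

lemma less_rev_single:
  assumes "var_less w v"
  shows "less_rev (single w 1) (single v 1)"
proof (rule less_rev_smallest_var)
  show "w \<in> keys (single w (1::nat))" by simp
  show "w \<notin> keys (single v (1::nat))" using assms var_less_irrefl[of v] by auto
  show "\<not> var_less u w" if "u \<in> keys (single w (1::nat)) \<union> keys (single v (1::nat))" for u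
    using that assms var_less_irrefl var_less_trans[of v w v] by (metis UnE keys_single singletonD empty_iff)
qed simp

lemma finite_bounded_monomials:
  fixes A :: "'a set"
  assumes "finite A"
  shows "finite {m. keys m \<subseteq> A \<and> mdeg m \<le> d}"
proof -
  let ?F = "{f :: _ \<Rightarrow> nat. \<forall>x. (x \<in> A \<longrightarrow> f x \<in> {..d}) \<and> (x \<notin> A \<longrightarrow> f x = 0)}"
  have "lookup m v \<le> mdeg m" for m :: "'a \<Rightarrow>\<^sub>0 nat" and v
    unfolding mdeg_def by (cases "v \<in> keys m") (auto intro: member_le_sum simp: in_keys_iff)
  then have "lookup m v \<le> d" if "mdeg m \<le> d" for m :: "'a \<Rightarrow>\<^sub>0 nat" and v
    using that order_trans by blast
  then have "lookup ` {m. keys m \<subseteq> A \<and> mdeg m \<le> d} \<subseteq> ?F"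
    by (auto simp: not_in_keys_iff_lookup_eq_zero)
  moreover have "finite ?F"
    using assms by (rule finite_set_of_finite_funs) simp
  ultimately have "finite (lookup ` {m. keys m \<subseteq> A \<and> mdeg m \<le> d})"
    by (rule finite_subset)
  then show ?thesis
    by (rule finite_imageD) (auto simp: inj_on_def intro: poly_mapping_eqI)
qed

text \<open>The order compares degrees first, so over finitely many variables a monomial has only
  finitely many smaller ones; their number is the measure.\<close>

lemma less_rev_induct [consumes 2, case_names less]:
  assumes "finite A" "keys m \<subseteq> A"
    and step: "\<And>m. keys m \<subseteq> A \<Longrightarrow> (\<And>n. keys n \<subseteq> A \<Longrightarrow> less_rev n m \<Longrightarrow> Q n) \<Longrightarrow> Q m"
  shows "Q m"
proof -
  define L where "L m = {n. keys n \<subseteq> A \<and> less_rev n m}" for m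
  have fin: "finite (L m)" for m
    by (rule finite_subset[OF _ finite_bounded_monomials[OF \<open>finite A\<close>, of "mdeg m"]])
      (auto simp: L_def less_rev_def)
  show ?thesis
    using \<open>keys m \<subseteq> A\<close>
  proof (induction "card (L m)" arbitrary: m rule: less_induct)
    case less
    show ?case
    proof (rule step[OF less.prems])
      fix n assume n: "keys n \<subseteq> A" "less_rev n m"
      have "L n \<subset> L m"
        using n less_rev_trans[OF _ n(2)] less_rev_irrefl[of n] unfolding L_def by blast
      then show "Q n"
        using less.hyps n fin psubset_card_mono by blast
    qed
  qed
qed

section \<open>The index set and the toric ideal\<close>

text \<open>All that is used of the index set once the poset is forgotten. \<open>step\<close> says
  that a proper poset ideal grows by a single element. \<open>rect\<close> fills the rectangle
  spanned by an antidiagonal pair: its other two corners are the meet and the join, and its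
  degenerate cases make rows and columns convex.\<close>

locale lattice_region =
  fixes A :: "(nat \<times> nat) set" and p q :: nat
  assumes bounded: "(i, j) \<in> A \<Longrightarrow> i \<le> p \<and> j \<le> q"
    and origin: "(0, 0) \<in> A"
    and step: "(i, j) \<in> A \<Longrightarrow> (i, j) \<noteq> (p, q) \<Longrightarrow> (Suc i, j) \<in> A \<or> (i, Suc j) \<in> A"
    and rect: "(i, j) \<in> A \<Longrightarrow> (k, l) \<in> A \<Longrightarrow> i \<le> x \<Longrightarrow> x \<le> k \<Longrightarrow> l \<le> y \<Longrightarrow> y \<le> j \<Longrightarrow> (x, y) \<in> A"
begin

lemma finite_region: "finite A"
  by (rule finite_subset[of _ "{..p} \<times> {..q}"]) (auto dest: bounded)

end

section \<open>The index set of a poset covered by two chains\<close>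

context
  fixes P :: "'a::order set" and a b p q
  assumes two_chain: "two_chain_poset P a b p q"
begin

lemma chain_a_le_iff: "s \<in> {1..p} \<Longrightarrow> t \<in> {1..p} \<Longrightarrow> a s \<le> a t \<longleftrightarrow> s \<le> t"
  using two_chain by (auto simp: two_chain_poset_def strict_mono_on_leD strict_mono_on_less_eq)

lemma chain_b_le_iff: "s \<in> {1..q} \<Longrightarrow> t \<in> {1..q} \<Longrightarrow> b s \<le> b t \<longleftrightarrow> s \<le> t"
  using two_chain by (auto simp: two_chain_poset_def strict_mono_on_leD strict_mono_on_less_eq)

lemma chains_disjoint: "s \<in> {1..p} \<Longrightarrow> t \<in> {1..q} \<Longrightarrow> a s \<noteq> b t"
  using two_chain unfolding two_chain_poset_def by (metis disjoint_iff imageI)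

lemma a_mem_alpha_iff: "s \<in> {1..p} \<Longrightarrow> i \<le> p \<Longrightarrow> j \<le> q \<Longrightarrow> a s \<in> \<alpha> a b (i, j) \<longleftrightarrow> s \<le> i"
proof -
  assume s: "s \<in> {1..p}" and ij: "i \<le> p" "j \<le> q"
  have "s = t" if "t \<in> {1..i}" "a s = a t" for t
    using chain_a_le_iff[of s t] chain_a_le_iff[of t s] that s ij by simp
  then show ?thesis
    using s ij chains_disjoint[OF s] by fastforce
qed

lemma b_mem_alpha_iff: "t \<in> {1..q} \<Longrightarrow> i \<le> p \<Longrightarrow> j \<le> q \<Longrightarrow> b t \<in> \<alpha> a b (i, j) \<longleftrightarrow> t \<le> j"
proof -
  assume t: "t \<in> {1..q}" and ij: "i \<le> p" "j \<le> q"
  have "t = s" if "s \<in> {1..j}" "b t = b s" for s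
    using chain_b_le_iff[of s t] chain_b_le_iff[of t s] that t ij by simp
  then show ?thesis
    using t ij chains_disjoint[OF _ t] by fastforce
qed

text \<open>Initial segments of a chain are closed within that chain, so only relations between the
  two chains can violate the ideal property.\<close>

lemma mem_index_set_iff:
  "(i, j) \<in> index_set P a b p q \<longleftrightarrow> i \<le> p \<and> j \<le> q \<and>
     (\<forall>s t. 1 \<le> s \<and> s \<le> i \<and> j < t \<and> t \<le> q \<longrightarrow> \<not> b t \<le> a s) \<and>
     (\<forall>s t. i < s \<and> s \<le> p \<and> 1 \<le> t \<and> t \<le> j \<longrightarrow> \<not> a s \<le> b t)"
proof (cases "i \<le> p \<and> j \<le> q")
  case True
  have P: "P = a ` {1..p} \<union> b ` {1..q}"
    using two_chain by (auto simp: two_chain_poset_def)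
  have sub: "\<alpha> a b (i, j) \<subseteq> P"
    unfolding P using True by fastforce
  have "poset_ideal P (\<alpha> a b (i, j)) \<longleftrightarrow>
     (\<forall>x\<in>\<alpha> a b (i, j). \<forall>y\<in>P. y \<le> x \<longrightarrow> y \<in> \<alpha> a b (i, j))"
    using sub by (simp add: poset_ideal_def del: \<alpha>.simps)
  also have "\<dots> \<longleftrightarrow> (\<forall>x\<in>\<alpha> a b (i, j). (\<forall>s\<in>{1..p}. a s \<le> x \<longrightarrow> a s \<in> \<alpha> a b (i, j)) \<and>
     (\<forall>t\<in>{1..q}. b t \<le> x \<longrightarrow> b t \<in> \<alpha> a b (i, j)))"
    by (simp only: P ball_Un ball_simps)
  also have "\<dots> \<longleftrightarrow>
     (\<forall>x\<in>\<alpha> a b (i, j). (\<forall>s\<in>{1..p}. a s \<le> x \<longrightarrow> s \<le> i) \<and> (\<forall>t\<in>{1..q}. b t \<le> x \<longrightarrow> t \<le> j))"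
    using True a_mem_alpha_iff[of _ i j] b_mem_alpha_iff[of _ i j] by blast
  also have "\<dots> \<longleftrightarrow>
     (\<forall>s\<in>{1..i}. (\<forall>s'\<in>{1..p}. a s' \<le> a s \<longrightarrow> s' \<le> i) \<and> (\<forall>t\<in>{1..q}. b t \<le> a s \<longrightarrow> t \<le> j)) \<and>
     (\<forall>t\<in>{1..j}. (\<forall>s\<in>{1..p}. a s \<le> b t \<longrightarrow> s \<le> i) \<and> (\<forall>t'\<in>{1..q}. b t' \<le> b t \<longrightarrow> t' \<le> j))"
    by (auto simp: ball_Un)
  also have "\<dots> \<longleftrightarrow>
     (\<forall>s t. 1 \<le> s \<and> s \<le> i \<and> j < t \<and> t \<le> q \<longrightarrow> \<not> b t \<le> a s) \<and>
     (\<forall>s t. i < s \<and> s \<le> p \<and> 1 \<le> t \<and> t \<le> j \<longrightarrow> \<not> a s \<le> b t)"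
    (is "?L \<longleftrightarrow> ?R")
  proof
    assume L: ?L
    show ?R
    proof (intro conjI allI impI notI; elim conjE)
      fix s t assume "1 \<le> s" "s \<le> i" "j < t" "t \<le> q" and le: "b t \<le> a s"
      then have "s \<in> {1..i}" "t \<in> {1..q}" by auto
      with L le have "t \<le> j" by blast
      with \<open>j < t\<close> show False by simp
    next
      fix s t assume "i < s" "s \<le> p" "1 \<le> t" "t \<le> j" and le: "a s \<le> b t"
      then have "t \<in> {1..j}" "s \<in> {1..p}" by auto
      with L le have "s \<le> i" by blast
      with \<open>i < s\<close> show False by simp
    qed
  next
    assume R: ?R
    show ?L
    proof (intro conjI ballI impI)
      fix s s' assume "s \<in> {1..i}" "s' \<in> {1..p}" "a s' \<le> a s"
      then show "s' \<le> i" using chain_a_le_iff[of s' s] True by auto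
    next
      fix t t' assume "t \<in> {1..j}" "t' \<in> {1..q}" "b t' \<le> b t"
      then show "t' \<le> j" using chain_b_le_iff[of t' t] True by auto
    next
      fix s t assume "s \<in> {1..i}" "t \<in> {1..q}" "b t \<le> a s"
      then show "t \<le> j" using R by (meson atLeastAtMost_iff not_le)
    next
      fix s t assume "t \<in> {1..j}" "s \<in> {1..p}" "a s \<le> b t"
      then show "s \<le> i" using R by (meson atLeastAtMost_iff not_le)
    qed
  qed
  finally show ?thesis
    using True by (simp add: index_set_def)
qed (auto simp: index_set_def)

lemma lattice_region_index_set: "lattice_region (index_set P a b p q) p q"
proof
  fix i j
  assume ij: "(i, j) \<in> index_set P a b p q"
  then show "i \<le> p \<and> j \<le> q" by (simp add: mem_index_set_iff)
  {
    fix k l x y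
    assume kl: "(k, l) \<in> index_set P a b p q" and "i \<le> x" "x \<le> k" "l \<le> y" "y \<le> j"
    then show "(x, y) \<in> index_set P a b p q"
      using ij kl unfolding mem_index_set_iff by (meson le_less_trans le_trans less_le_trans)
  }
  assume ne: "(i, j) \<noteq> (p, q)"
  show "(Suc i, j) \<in> index_set P a b p q \<or> (i, Suc j) \<in> index_set P a b p q"
  proof (rule ccontr)
    assume neg: "\<not> ?thesis"
    have le: "i \<le> p" "j \<le> q" using ij by (auto simp: mem_index_set_iff)
    \<comment> \<open>If neither next element can be added, each one needs the other below it, so
      the two are equal although the chains are disjoint.\<close>
    have 1: "j < q \<and> b (Suc j) \<le> a (Suc i)" if "i < p"
    proof -
      obtain s t where t: "1 \<le> s" "s \<le> Suc i" "j < t" "t \<le> q" "b t \<le> a s"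
        using neg ij \<open>i < p\<close> unfolding mem_index_set_iff by (meson Suc_leI Suc_lessD)
      moreover have "\<not> s \<le> i"
        using ij t unfolding mem_index_set_iff by blast
      ultimately have t: "j < t" "t \<le> q" "b t \<le> a (Suc i)"
        by (auto simp: le_Suc_eq)
      then show ?thesis
        using chain_b_le_iff[of "Suc j" t] by (auto intro: order_trans)
    qed
    have 2: "i < p \<and> a (Suc i) \<le> b (Suc j)" if "j < q"
    proof -
      obtain s t where s: "1 \<le> t" "t \<le> Suc j" "i < s" "s \<le> p" "a s \<le> b t"
        using neg ij \<open>j < q\<close> unfolding mem_index_set_iff by (meson Suc_leI Suc_lessD)
      moreover have "\<not> t \<le> j"
        using ij s unfolding mem_index_set_iff by blast
      ultimately have s: "i < s" "s \<le> p" "a s \<le> b (Suc j)"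
        by (auto simp: le_Suc_eq)
      then show ?thesis
        using chain_a_le_iff[of "Suc i" s] by (auto intro: order_trans)
    qed
    have "i < p" "j < q" using 1 2 le ne by auto
    then have "a (Suc i) = b (Suc j)" using 1 2 by (auto intro: antisym)
    then show False using chains_disjoint[of "Suc i" "Suc j"] \<open>i < p\<close> \<open>j < q\<close> by simp
  qed
next
  show "(0, 0) \<in> index_set P a b p q" by (simp add: mem_index_set_iff)
qed

end

section \<open>Initial monomials of the toric ideal\<close>

definition antidiagonal :: "nat \<times> nat \<Rightarrow> nat \<times> nat \<Rightarrow> bool" where
  "antidiagonal v w \<longleftrightarrow> fst v < fst w \<and> snd w < snd v"

lemma X_mult_X: "X v * X w = single (single v 1 + single w 1) 1"
  by (simp add: X_def mult_single)

lemma initial_ideal_generator: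
  assumes "f \<in> I" "is_initial m f"
  shows "single m 1 \<in> initial_ideal A I"
proof -
  have "f \<noteq> 0" using assms(2) by (auto simp: is_initial_def)
  then show ?thesis
    unfolding initial_ideal_def using assms
    by (intro ideal_in_generator is_subring_Kx) blast
qed

text \<open>The Hibi relation: the product of \<open>v\<close> and \<open>w\<close> minus the
  product of their meet and join lies in the toric ideal, since union and intersection together
  contain each poset element as often as the two ideals do.\<close>

lemma antidiagonal_in_initial_toric:
  assumes two_chain: "two_chain_poset P a b p q" and A: "A = index_set P a b p q"
    and v: "v \<in> A" and w: "w \<in> A" and vw: "antidiagonal v w"
  shows "X v * X w \<in> initial_ideal A (toric_ideal A a b)"
proof -
  interpret lattice_region A p q
    unfolding A by (rule lattice_region_index_set[OF two_chain])
  obtain i j k l where [simp]: "v = (i, j)" "w = (k, l)" by fastforce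
  have ij: "i < k" "l < j" using vw by (auto simp: antidiagonal_def)
  define u t where "u = (i, l)" and "t = (k, j)"
  have ut: "u \<in> A" "t \<in> A"
    using rect[of i j k l i l] rect[of i j k l k j] v w ij by (auto simp: u_def t_def)
  let ?m = "single v 1 + single w (1::nat)" and ?n = "single u 1 + single t (1::nat)"
  define f :: "(nat \<times> nat, ratfun) mpoly" where "f = X v * X w - X u * X t"
  let ?\<phi> = "\<lambda>v. X None * (\<Prod>c\<in>\<alpha> a b v. X (Some c)) :: ('a option, ratfun) mpoly"
  \<comment> \<open>The join \<open>t\<close> has the largest coordinate sum of the four points,
    hence is the smallest variable, and it occurs only in \<open>?n\<close>.\<close>
  have less: "less_rev ?n ?m"
    by (rule less_rev_smallest_var[of _ _ t])
      (use ij in \<open>auto simp: keys_add_nat mdeg_add u_def t_def\<close>)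
  then have ne: "?n \<noteq> ?m" using less_rev_irrefl by metis
  have "keys f \<subseteq> {?m, ?n}"
    unfolding f_def X_mult_X by (rule order_trans[OF keys_diff_subset]) auto
  moreover have "lookup f ?m = 1"
    using ne by (simp add: f_def X_mult_X lookup_minus lookup_single)
  ultimately have init: "is_initial ?m f"
    using less by (auto simp: is_initial_def in_keys_iff)
  have fin: "finite (\<alpha> a b x)" for x by (cases x) simp
  have disj: "a ` {1..i'} \<inter> b ` {1..j'} = {}" if "i' \<le> p" "j' \<le> q" for i' j'
    using chains_disjoint[OF two_chain] that by fastforce
  have le: "k \<le> p" "j \<le> q" using v w bounded by auto
  have union: "\<alpha> a b v \<union> \<alpha> a b w = \<alpha> a b t"
    using ij by (auto simp: t_def)
  have inter: "\<alpha> a b v \<inter> \<alpha> a b w = \<alpha> a b u"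
    using ij disj[OF le] by (fastforce simp: u_def)
  have "(\<Prod>c\<in>\<alpha> a b v. X (Some c)) * (\<Prod>c\<in>\<alpha> a b w. X (Some c))
      = ((\<Prod>c\<in>\<alpha> a b t. X (Some c)) * (\<Prod>c\<in>\<alpha> a b u. X (Some c)) :: ('a option, ratfun) mpoly)"
    unfolding union[symmetric] inter[symmetric] by (rule prod.union_inter[symmetric]) (rule fin)+
  then have "?\<phi> v * ?\<phi> w = ?\<phi> u * ?\<phi> t"
    by (simp only: mult_ac)
  then have "subst ?\<phi> f = 0"
    by (simp only: f_def subst_eq_peval coeff_hom.peval_diff[OF coeff_hom_const] 
        coeff_hom.peval_mult[OF coeff_hom_const] coeff_hom.peval_X[OF coeff_hom_const]) simp
  moreover have "f \<in> Kx A"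
    unfolding f_def using v w ut X_in_polys[OF is_subring_ratfun_field, of _ A A]
    by (intro is_subring_diff[OF is_subring_Kx])
      (use is_subring_Kx[of A] in \<open>auto simp: Kx_def is_subring_def simp del: \<open>v = _\<close> \<open>w = _\<close>\<close>)
  ultimately have "f \<in> toric_ideal A a b"
    by (simp add: toric_ideal_def)
  from initial_ideal_generator[OF this init] show ?thesis
    by (simp add: X_mult_X)
qed

lemma single_power_one:
  "(single u 1 :: ('v, 'c::comm_ring_1) mpoly) ^ k = single (\<Sum>i<k. u) 1"
  by (induction k) (auto simp: mult_single add.commute)

lemma prod_single_one:
  "(\<Prod>v\<in>S. single (g v) 1 :: ('v, 'c::comm_ring_1) mpoly) = single (\<Sum>v\<in>S. g v) 1"
  by (induction S rule: infinite_finite_induct) (auto simp: mult_single)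

text \<open>Without antidiagonal pairs the exponent sum over each quadrant is the minimum of a row sum and a
  column sum, hence the largest one in the fibre; a smaller monomial of the fibre would exceed it
  at the smallest variable where the two differ.\<close>

lemma multichain_least_in_fibre:
  assumes fin: "finite A" and m: "keys m \<subseteq> A" and n: "keys n \<subseteq> A"
    and chain: "\<And>v w. v \<in> keys m \<Longrightarrow> w \<in> keys m \<Longrightarrow> \<not> antidiagonal v w"
    and rows: "\<And>i j. (i, j) \<in> A \<Longrightarrow>
      (\<Sum>v\<in>{v\<in>A. i \<le> fst v}. lookup m v) = (\<Sum>v\<in>{v\<in>A. i \<le> fst v}. lookup n v)"
    and cols: "\<And>i j. (i, j) \<in> A \<Longrightarrow>
      (\<Sum>v\<in>{v\<in>A. j \<le> snd v}. lookup m v) = (\<Sum>v\<in>{v\<in>A. j \<le> snd v}. lookup n v)"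
    and deg: "mdeg m = mdeg n"
  shows "\<not> less_rev n m"
proof
  assume "less_rev n m"
  then obtain v where v: "lookup m v < lookup n v"
    and eq: "\<And>w. var_less w v \<Longrightarrow> lookup n w = lookup m w"
    using deg unfolding less_rev_def by (metis order.irrefl)
  have "v \<in> keys n" using v by (simp add: in_keys_iff)
  then have "v \<in> A" using n by blast
  obtain i j where ij: "v = (i, j)" by fastforce
  let ?Q = "{w\<in>A. i \<le> fst w \<and> j \<le> snd w}"
  let ?R = "{w\<in>A. i \<le> fst w}" and ?C = "{w\<in>A. j \<le> snd w}"
  have finQ: "finite ?Q" using fin by simp
  have vQ: "v \<in> ?Q" using \<open>v \<in> A\<close> ij by simp
  have "(\<Sum>w\<in>?Q - {v}. lookup m w) = (\<Sum>w\<in>?Q - {v}. lookup n w)"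
  proof (rule sum.cong[OF refl])
    fix w assume "w \<in> ?Q - {v}"
    then have "var_less w v" by (cases w) (auto simp: ij)
    then show "lookup m w = lookup n w" using eq by simp
  qed
  then have less: "(\<Sum>w\<in>?Q. lookup m w) < (\<Sum>w\<in>?Q. lookup n w)"
    using v by (simp add: sum.remove[OF finQ vQ])
  show False
  proof (cases "\<exists>w\<in>keys m. i \<le> fst w \<and> snd w < j")
    case True
    then have "i \<le> fst w" if "w \<in> keys m" "j \<le> snd w" for w
      using that chain[of w] by (force simp: antidiagonal_def)
    then have "(\<Sum>w\<in>?Q. lookup m w) = (\<Sum>w\<in>?C. lookup m w)"
      using fin by (intro sum.mono_neutral_left) (auto simp: in_keys_iff)
    also have "\<dots> = (\<Sum>w\<in>?C. lookup n w)"
      using cols \<open>v \<in> A\<close> ij by blast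
    also have "\<dots> \<ge> (\<Sum>w\<in>?Q. lookup n w)"
      using fin by (intro sum_mono2) auto
    finally show False using less by simp
  next
    case False
    then have "(\<Sum>w\<in>?Q. lookup m w) = (\<Sum>w\<in>?R. lookup m w)"
      using fin by (intro sum.mono_neutral_left) (auto simp: in_keys_iff not_less)
    also have "\<dots> = (\<Sum>w\<in>?R. lookup n w)"
      using rows \<open>v \<in> A\<close> ij by blast
    also have "\<dots> \<ge> (\<Sum>w\<in>?Q. lookup n w)"
      using fin by (intro sum_mono2) auto
    finally show False using less by simp
  qed
qed

text \<open>The kernel condition makes the coefficients over each fibre of the monomial map sum to
  zero. A monomial without antidiagonal pairs is least in its fibre, so it cannot be initial: it
  would need a smaller partner there.\<close>

lemma toric_initial_antidiagonal:
  assumes two_chain: "two_chain_poset P a b p q" and A: "A = index_set P a b p q"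
    and f: "f \<in> toric_ideal A a b" and init: "is_initial m f"
  shows "\<exists>v\<in>keys m. \<exists>w\<in>keys m. antidiagonal v w"
proof (rule ccontr)
  assume no: "\<not> ?thesis"
  interpret lattice_region A p q
    unfolding A by (rule lattice_region_index_set[OF two_chain])
  \<comment> \<open>The substitution sends monomials to monomials; \<open>u v\<close> is the
    exponent of the image of \<open>X v\<close>, and \<open>img n\<close> that of the image of the
    monomial \<open>n\<close>.\<close>
  define u where "u v = single None (1::nat) + (\<Sum>c\<in>\<alpha> a b v. single (Some c) 1)" for v
  define img where "img n = (\<Sum>v\<in>keys n. \<Sum>i<lookup n v. u v)" for n :: "nat \<times> nat \<Rightarrow>\<^sub>0 nat"
  let ?\<phi> = "\<lambda>v. X None * (\<Prod>c\<in>\<alpha> a b v. X (Some c)) :: ('a option, ratfun) mpoly"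
  have "?\<phi> v = single (u v) 1" for v
    by (simp add: X_def u_def prod_single_one mult_single)
  then have meval: "meval ?\<phi> n = single (img n) 1" for n
    by (simp add: meval_def single_power_one prod_single_one img_def)
  have keysA: "keys n \<subseteq> A" if "n \<in> keys f" for n
    using f that by (auto simp: toric_ideal_def Kx_def polys_def)
  have m: "m \<in> keys f" and less: "\<And>n. n \<in> keys f \<Longrightarrow> n \<noteq> m \<Longrightarrow> less_rev n m"
    using init by (auto simp: is_initial_def)
  have "0 = lookup (subst ?\<phi> f) (img m)"
    using f by (simp add: toric_ideal_def)
  also have "\<dots> = (\<Sum>n\<in>keys f. lookup f n when img n = img m)"
    unfolding subst_eq_peval peval_def meval
    by (simp add: const_def mult_single lookup_sum lookup_single)
  finally have sum0: "(\<Sum>n\<in>keys f. lookup f n when img n = img m) = 0" by simp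
  \<comment> \<open>The coefficient of \<open>m\<close> alone is nonzero, so another term of the
    same fibre must cancel it.\<close>
  have "\<exists>n\<in>keys f. n \<noteq> m \<and> img n = img m"
  proof (rule ccontr)
    assume "\<not> ?thesis"
    then have "(\<Sum>n\<in>keys f. lookup f n when img n = img m) = (\<Sum>n\<in>keys f. if n = m then lookup f n else 0)"
      by (intro sum.cong) auto
    also have "\<dots> = lookup f m" using m by simp
    finally show False using sum0 m by (simp add: in_keys_iff)
  qed
  then obtain n where n: "n \<in> keys f" "n \<noteq> m" "img n = img m" by blast
  have lookup_img: "lookup (img n) x = (\<Sum>v\<in>A. lookup n v * lookup (u v) x)" if "keys n \<subseteq> A" for n :: "nat \<times> nat \<Rightarrow>\<^sub>0 nat" and x
    unfolding img_def lookup_sum using that finite_region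
    by (simp, intro sum.mono_neutral_left) (auto simp: not_in_keys_iff_lookup_eq_zero)
  have lookup_u: "lookup (u v) (Some c) = (if c \<in> \<alpha> a b v then 1 else 0)" "lookup (u v) None = 1" for v c
  proof -
    have "finite (\<alpha> a b v)" by (cases v) simp
    then show "lookup (u v) (Some c) = (if c \<in> \<alpha> a b v then 1 else 0)" "lookup (u v) None = 1"
      by (simp_all add: u_def lookup_add lookup_sum lookup_single when_def)
  qed
  have total: "lookup (img n) None = (\<Sum>v\<in>A. lookup n v)" if "keys n \<subseteq> A" for n :: "nat \<times> nat \<Rightarrow>\<^sub>0 nat"
    using that by (simp add: lookup_img lookup_u)
  have row: "lookup (img n) (Some (a i)) = (\<Sum>v\<in>{v\<in>A. i \<le> fst v}. lookup n v)"
    if "keys n \<subseteq> A" "i \<in> {1..p}" for n :: "nat \<times> nat \<Rightarrow>\<^sub>0 nat" and i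
  proof -
    have "a i \<in> \<alpha> a b v \<longleftrightarrow> i \<le> fst v" if "v \<in> A" for v
      using that \<open>i \<in> _\<close> bounded[of "fst v" "snd v"] a_mem_alpha_iff[OF two_chain, of i "fst v" "snd v"]
      by simp
    then have "lookup (img n) (Some (a i)) = (\<Sum>v\<in>A. if i \<le> fst v then lookup n v else 0)"
      using that(1) by (simp add: lookup_img lookup_u) (rule sum.cong, auto)
    then show ?thesis
      by (simp add: sum.inter_filter finite_region)
  qed
  have col: "lookup (img n) (Some (b i)) = (\<Sum>v\<in>{v\<in>A. i \<le> snd v}. lookup n v)"
    if "keys n \<subseteq> A" "i \<in> {1..q}" for n :: "nat \<times> nat \<Rightarrow>\<^sub>0 nat" and i
  proof -
    have "b i \<in> \<alpha> a b v \<longleftrightarrow> i \<le> snd v" if "v \<in> A" for v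
      using that \<open>i \<in> _\<close> bounded[of "fst v" "snd v"] b_mem_alpha_iff[OF two_chain, of i "fst v" "snd v"]
      by simp
    then have "lookup (img n) (Some (b i)) = (\<Sum>v\<in>A. if i \<le> snd v then lookup n v else 0)"
      using that(1) by (simp add: lookup_img lookup_u) (rule sum.cong, auto)
    then show ?thesis
      by (simp add: sum.inter_filter finite_region)
  qed
  have "\<not> less_rev n m"
  proof (rule multichain_least_in_fibre[OF finite_region])
    show "keys m \<subseteq> A" "keys n \<subseteq> A" using keysA m n by auto
    note mn = this
    show "\<not> antidiagonal v w" if "v \<in> keys m" "w \<in> keys m" for v w
      using no that by blast
    \<comment> \<open>No chain element has index 0; the tail sum from 0 is the total degree, which
      the homogenizing variable records.\<close>
    have tot: "(\<Sum>v\<in>A. lookup m v) = (\<Sum>v\<in>A. lookup n v)"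
      using total mn n(3) by metis
    then show "mdeg m = mdeg n"
      using mn finite_region by (simp add: mdeg_superset)
    fix i j assume ij: "(i, j) \<in> A"
    show "(\<Sum>v\<in>{v\<in>A. i \<le> fst v}. lookup m v) = (\<Sum>v\<in>{v\<in>A. i \<le> fst v}. lookup n v)"
      using tot row[of m i] row[of n i] mn n(3) bounded[OF ij] by (cases "i = 0") auto
    show "(\<Sum>v\<in>{v\<in>A. j \<le> snd v}. lookup m v) = (\<Sum>v\<in>{v\<in>A. j \<le> snd v}. lookup n v)"
      using tot col[of m j] col[of n j] mn n(3) bounded[OF ij] by (cases "j = 0") auto
  qed
  then show False using less n by blast
qed

section \<open>Reducing monomials\<close>

definition inner_points :: "(nat \<times> nat) set \<Rightarrow> (nat \<times> nat) set" where
  "inner_points A = {v\<in>A. snd v \<noteq> j_sharp A (fst v) \<and> fst v \<noteq> i_flat A (snd v)}"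

definition strictly_below :: "nat \<times> nat \<Rightarrow> nat \<times> nat \<Rightarrow> bool" where
  "strictly_below v w \<longleftrightarrow> fst v < fst w \<and> snd v < snd w"

definition std_exponents :: "(nat \<times> nat) set \<Rightarrow> (nat \<times> nat \<Rightarrow>\<^sub>0 nat) set" where
  "std_exponents A = {m. keys m \<subseteq> inner_points A \<and> (\<forall>v\<in>keys m. lookup m v = 1) \<and>
     (\<forall>v\<in>keys m. \<forall>w\<in>keys m. v \<noteq> w \<longrightarrow> strictly_below v w \<or> strictly_below w v)}"

lemma const_mult_single: "const c * single m d = single m (c * d)"
  by (simp add: const_def mult_single)

lemma X_mult_linear:
  "X v * ((\<Sum>u\<in>U. const (x u) * X u) - const c)
    = (\<Sum>u\<in>U. single (single v 1 + single u 1) (x u)) - single (single v 1) c"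
  by (simp add: right_diff_distrib sum_distrib_left X_def const_def mult_single add.commute)

definition lower_polys ::
  "(nat \<times> nat) set \<Rightarrow> (nat \<times> nat \<Rightarrow>\<^sub>0 nat) \<Rightarrow> (nat \<times> nat, 'c::comm_ring_1) mpoly set" where
  "lower_polys A u = {f. \<forall>n\<in>keys f. keys n \<subseteq> A \<and> less_rev n u}"

lemma lower_polys_zero [simp]: "0 \<in> lower_polys A u"
  by (simp add: lower_polys_def)

lemma lower_polys_single: "keys n \<subseteq> A \<Longrightarrow> less_rev n u \<Longrightarrow> single n c \<in> lower_polys A u"
  by (simp add: lower_polys_def)

lemma lower_polys_diff: "f \<in> lower_polys A u \<Longrightarrow> g \<in> lower_polys A u \<Longrightarrow> f - g \<in> lower_polys A u"
  using keys_diff_subset[of f g] unfolding lower_polys_def by blast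

lemma lower_polys_add: "f \<in> lower_polys A u \<Longrightarrow> g \<in> lower_polys A u \<Longrightarrow> f + g \<in> lower_polys A u"
  using Poly_Mapping.keys_add[of f g] unfolding lower_polys_def by blast

lemma lower_polys_sum: "(\<And>s. s \<in> S \<Longrightarrow> F s \<in> lower_polys A u) \<Longrightarrow> sum F S \<in> lower_polys A u"
  by (induction S rule: infinite_finite_induct) (auto intro: lower_polys_add)

lemma lower_polys_mult:
  assumes "f \<in> lower_polys A u" "keys t \<subseteq> A"
  shows "single t 1 * f \<in> lower_polys A (t + u)"
proof -
  have "single t 1 * f = (\<Sum>n\<in>keys f. single (t + n) (lookup f n))"
    using poly_mapping_eq_sum_single[of f] by (metis (no_types, lifting) mult_single mult_1 sum.cong sum_distrib_left)
  also have "\<dots> \<in> lower_polys A (t + u)"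
    using assms by (intro lower_polys_sum lower_polys_single)
      (auto simp: lower_polys_def keys_add_nat intro: less_rev_add)
  finally show ?thesis .
qed

text \<open>The forms are required for every index, also beyond \<open>p\<close> and
  \<open>q\<close>, so that the last row and column are differences of consecutive forms like all
  others.\<close>

locale reduction = lattice_region +
  fixes C :: "'c::comm_ring_1 set" and x :: "nat \<times> nat \<Rightarrow> 'c" and \<eta>r \<eta>c :: "nat \<Rightarrow> 'c"
    and I :: "(nat \<times> nat, 'c) mpoly set"
  assumes subring: "is_subring C"
    and coeff_mem: "v \<in> A \<Longrightarrow> x v \<in> C"
    and ideal: "is_ideal (polys C A) I"
    and antidiagonal_mem: "v \<in> A \<Longrightarrow> w \<in> A \<Longrightarrow> antidiagonal v w \<Longrightarrow> X v * X w \<in> I"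
    and theta_row_mem: "(\<Sum>v\<in>{v\<in>A. i \<le> fst v}. const (x v) * X v) - const (\<eta>r i) \<in> I"
    and theta_col_mem: "(\<Sum>v\<in>{v\<in>A. j \<le> snd v}. const (x v) * X v) - const (\<eta>c j) \<in> I"
begin

text \<open>The leading coefficient is pinned to a power of some \<open>x v\<close>, since
  \<open>C\<close> need not be a field and these powers are units in both applications. The exponent
  is 0 for antidiagonal pairs, 2 for squares and 1 for the other basic relations.\<close>

definition reducible :: "(nat \<times> nat \<Rightarrow>\<^sub>0 nat) \<Rightarrow> bool" where
  "reducible u \<longleftrightarrow> (\<exists>f\<in>I. \<exists>v\<in>A. \<exists>e. f - single u (x v ^ e) \<in> lower_polys A u)"

lemmas ring = is_subring_polys[OF subring, of A]
lemmas ideal_diff = is_ideal_diff[OF ring ideal]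
lemmas ideal_sum = is_ideal_sum[OF ideal]

lemma ideal_mult: "r \<in> polys C A \<Longrightarrow> f \<in> I \<Longrightarrow> r * f \<in> I"
  using ideal by (simp add: is_ideal_def)

lemma X_mult_mem: "v \<in> A \<Longrightarrow> f \<in> I \<Longrightarrow> X v * f \<in> I"
  by (intro ideal_mult X_in_polys subring)

lemma const_mult_mem: "v \<in> A \<Longrightarrow> f \<in> I \<Longrightarrow> const (x v) * f \<in> I"
  by (intro ideal_mult const_in_polys subring coeff_mem)

lemma antidiagonal_single_mem:
  assumes "v \<in> A" "w \<in> A" "antidiagonal v w \<or> antidiagonal w v"
  shows "single (single v 1 + single w 1) (x w) \<in> I"
proof -
  have "X v * X w \<in> I"
    using assms antidiagonal_mem[of v w] antidiagonal_mem[of w v] by (auto simp: mult.commute)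
  then have "const (x w) * (X v * X w) \<in> I"
    by (rule const_mult_mem[OF assms(2)])
  then show ?thesis by (simp add: X_mult_X const_mult_single)
qed

lemma row_form_mem:
  "(\<Sum>v\<in>{v\<in>A. fst v = i}. const (x v) * X v) - const (\<eta>r i - \<eta>r (Suc i)) \<in> I"
proof -
  have split: "{v\<in>A. i \<le> fst v} = {v\<in>A. fst v = i} \<union> {v\<in>A. Suc i \<le> fst v}" by auto
  have "(\<Sum>v\<in>{v\<in>A. i \<le> fst v}. const (x v) * X v)
    = (\<Sum>v\<in>{v\<in>A. fst v = i}. const (x v) * X v) + (\<Sum>v\<in>{v\<in>A. Suc i \<le> fst v}. const (x v) * X v)"
    unfolding split using finite_region by (subst sum.union_disjoint) auto
  then show ?thesis
    using ideal_diff[OF theta_row_mem[of i] theta_row_mem[of "Suc i"]]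
    by (simp add: const_def single_diff algebra_simps)
qed

lemma col_form_mem:
  "(\<Sum>v\<in>{v\<in>A. snd v = j}. const (x v) * X v) - const (\<eta>c j - \<eta>c (Suc j)) \<in> I"
proof -
  have split: "{v\<in>A. j \<le> snd v} = {v\<in>A. snd v = j} \<union> {v\<in>A. Suc j \<le> snd v}" by auto
  have "(\<Sum>v\<in>{v\<in>A. j \<le> snd v}. const (x v) * X v)
    = (\<Sum>v\<in>{v\<in>A. snd v = j}. const (x v) * X v) + (\<Sum>v\<in>{v\<in>A. Suc j \<le> snd v}. const (x v) * X v)"
    unfolding split using finite_region by (subst sum.union_disjoint) auto
  then show ?thesis
    using ideal_diff[OF theta_col_mem[of j] theta_col_mem[of "Suc j"]]
    by (simp add: const_def single_diff algebra_simps)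
qed

lemma reducible_linear:
  assumes v: "v \<in> A" and U: "U \<subseteq> A" "v \<in> U"
    and mem: "(\<Sum>u\<in>U. const (x u) * X u) - const c \<in> I"
    and less: "\<And>u. u \<in> U \<Longrightarrow> u \<noteq> v \<Longrightarrow> var_less u v"
  shows "reducible (single v 1)"
proof -
  have fin: "finite U" using U finite_region finite_subset by blast
  have "(\<Sum>u\<in>U. const (x u) * X u) - const c - single (single v 1) (x v)
      = (\<Sum>u\<in>U - {v}. single (single u 1) (x u)) - single 0 c"
    using fin U by (simp add: sum.remove[of U v] X_def const_def mult_single)
  also have "\<dots> \<in> lower_polys A (single v 1)"
    using U by (intro lower_polys_diff lower_polys_sum lower_polys_single less_rev_single less)
      (auto intro: less_rev_degree)
  finally show ?thesis
    unfolding reducible_def using mem v by (intro bexI exI[of _ 1]) auto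
qed

text \<open>Within a row a smaller second coordinate means a smaller coordinate sum and hence a
  larger variable, so the first point of the row leads its linear form.\<close>

lemma reducible_sharp:
  assumes "(i, j_sharp A i) \<in> A"
  shows "reducible (single (i, j_sharp A i) 1)"
proof (rule reducible_linear[OF assms _ _ row_form_mem])
  fix u assume "u \<in> {v \<in> A. fst v = i}" "u \<noteq> (i, j_sharp A i)"
  then show "var_less u (i, j_sharp A i)"
    using Least_le[of "\<lambda>j. (i, j) \<in> A" "snd u"] by (cases u) (auto simp: j_sharp_def)
qed (use assms in auto)

lemma reducible_flat:
  assumes "(i_flat A j, j) \<in> A"
  shows "reducible (single (i_flat A j, j) 1)"
proof (rule reducible_linear[OF assms _ _ col_form_mem])
  fix u assume "u \<in> {v \<in> A. snd v = j}" "u \<noteq> (i_flat A j, j)"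
  then show "var_less u (i_flat A j, j)"
    using Least_le[of "\<lambda>i. (i, j) \<in> A" "fst u"] by (cases u) (auto simp: i_flat_def)
qed (use assms in auto)

text \<open>Multiplying a form by \<open>X v\<close> turns the terms antidiagonal to
  \<open>v\<close> into members of \<open>I\<close>, so only those in \<open>W\<close>
  survive.\<close>

lemma X_mult_form_mem:
  assumes v: "v \<in> A" and U: "U \<subseteq> A" "W \<subseteq> U"
    and mem: "(\<Sum>u\<in>U. const (x u) * X u) - const c \<in> I"
    and anti: "\<And>u. u \<in> U - W \<Longrightarrow> antidiagonal v u \<or> antidiagonal u v"
  shows "(\<Sum>u\<in>W. single (single v 1 + single u 1) (x u)) - single (single v 1) c \<in> I"
proof -
  have fin: "finite U" using U finite_region finite_subset by blast
  have "(\<Sum>u\<in>U - W. single (single v 1 + single u 1) (x u)) \<in> I"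
    using v U anti by (intro ideal_sum antidiagonal_single_mem) auto
  from ideal_diff[OF X_mult_mem[OF v mem] this] show ?thesis
    using fin U unfolding X_mult_linear by (simp add: sum.subset_diff[of W U])
qed

text \<open>The form to multiply by is that of column \<open>l\<close>, not of row \<open>i\<close>:
  its points with first coordinate below \<open>i\<close> are antidiagonal to \<open>(i, j)\<close>,
  which leaves \<open>(i, l)\<close> as the leading point.\<close>

lemma reducible_same_row:
  assumes v: "(i, j) \<in> A" and w: "(i, l) \<in> A" and jl: "j < l"
  shows "reducible (single (i, j) 1 + single (i, l) 1)"
proof -
  let ?W = "{u\<in>A. snd u = l \<and> i \<le> fst u}"
  let ?e = "\<lambda>u. single (i, j) 1 + single u (1::nat)"
  obtain c where mem: "(\<Sum>u\<in>?W. single (?e u) (x u)) - single (single (i, j) 1) c \<in> I"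
  proof (rule that)
    show "(\<Sum>u\<in>?W. single (?e u) (x u)) - single (single (i, j) 1) (\<eta>c l - \<eta>c (Suc l)) \<in> I"
      by (rule X_mult_form_mem[OF v _ _ col_form_mem]) (use jl in \<open>auto simp: antidiagonal_def\<close>)
  qed
  have "(\<Sum>u\<in>?W. single (?e u) (x u)) - single (single (i, j) 1) c - single (?e (i, l)) (x (i, l) ^ 1)
      = (\<Sum>u\<in>?W - {(i, l)}. single (?e u) (x u)) - single (single (i, j) 1) c"
    using w finite_region by (simp add: sum.remove[of ?W "(i, l)"])
  also have "\<dots> \<in> lower_polys A (?e (i, l))"
    by (intro lower_polys_diff lower_polys_sum lower_polys_single less_rev_add less_rev_single less_rev_degree)
      (use v in \<open>auto simp: keys_add_nat mdeg_add\<close>)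
  finally show ?thesis
    unfolding reducible_def using mem w by blast
qed

lemma reducible_same_col:
  assumes v: "(i, j) \<in> A" and w: "(k, j) \<in> A" and ik: "i < k"
  shows "reducible (single (i, j) 1 + single (k, j) 1)"
proof -
  let ?W = "{u\<in>A. fst u = k \<and> j \<le> snd u}"
  let ?e = "\<lambda>u. single (i, j) 1 + single u (1::nat)"
  obtain c where mem: "(\<Sum>u\<in>?W. single (?e u) (x u)) - single (single (i, j) 1) c \<in> I"
  proof (rule that)
    show "(\<Sum>u\<in>?W. single (?e u) (x u)) - single (single (i, j) 1) (\<eta>r k - \<eta>r (Suc k)) \<in> I"
      by (rule X_mult_form_mem[OF v _ _ row_form_mem]) (use ik in \<open>auto simp: antidiagonal_def\<close>)
  qed
  have "(\<Sum>u\<in>?W. single (?e u) (x u)) - single (single (i, j) 1) c - single (?e (k, j)) (x (k, j) ^ 1)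
      = (\<Sum>u\<in>?W - {(k, j)}. single (?e u) (x u)) - single (single (i, j) 1) c"
    using w finite_region by (simp add: sum.remove[of ?W "(k, j)"])
  also have "\<dots> \<in> lower_polys A (?e (k, j))"
    by (intro lower_polys_diff lower_polys_sum lower_polys_single less_rev_add less_rev_single less_rev_degree)
      (use v in \<open>auto simp: keys_add_nat mdeg_add\<close>)
  finally show ?thesis
    unfolding reducible_def using mem w by blast
qed

text \<open>With \<open>v = (i, j)\<close>, the product of \<open>X v\<close> and the difference of the linear forms of the rows
  \<open>\<ge> i\<close> and of the columns \<open>> j\<close> contains \<open>X v * X v\<close> below the products \<open>X w * X v\<close> with \<open>w\<close> to
  the left of \<open>v\<close> in row \<open>i\<close>; those are cancelled by the relation behind \<open>reducible_same_row\<close>.\<close>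

lemma reducible_square:
  assumes v: "v \<in> A"
  shows "reducible (single v 1 + single v 1)"
proof -
  obtain i j where ij: "v = (i, j)" by fastforce
  let ?e = "\<lambda>w u. single w 1 + single u (1::nat)"
  define L where "L = {u\<in>A. fst u = i \<and> snd u < j}"
  define D where "D = {u\<in>A. i < fst u \<and> snd u = j}"
  define B where "B = {u\<in>A. i \<le> fst u \<and> j < snd u}"
  have fin: "finite L" "finite D" "finite B" and sub: "L \<subseteq> A" "D \<subseteq> A"
    using finite_region by (auto simp: L_def D_def B_def)
  have "(\<Sum>u\<in>insert v (L \<union> D \<union> B). single (?e v u) (x u)) - single (single v 1) (\<eta>r i) \<in> I"
    by (rule X_mult_form_mem[OF v _ _ theta_row_mem])
      (use v in \<open>auto simp: ij L_def D_def B_def antidiagonal_def\<close>)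
  moreover have "(\<Sum>u\<in>B. single (?e v u) (x u)) - single (single v 1) (\<eta>c (Suc j)) \<in> I"
    by (rule X_mult_form_mem[OF v _ _ theta_col_mem])
      (auto simp: ij B_def antidiagonal_def)
  ultimately have "(\<Sum>u\<in>insert v (L \<union> D \<union> B). single (?e v u) (x u)) - single (single v 1) (\<eta>r i)
      - ((\<Sum>u\<in>B. single (?e v u) (x u)) - single (single v 1) (\<eta>c (Suc j))) \<in> I"
    by (rule ideal_diff)
  moreover have "(\<Sum>u\<in>insert v (L \<union> D \<union> B). single (?e v u) (x u)) = single (?e v v) (x v)
      + (\<Sum>u\<in>L. single (?e v u) (x u)) + (\<Sum>u\<in>D. single (?e v u) (x u)) + (\<Sum>u\<in>B. single (?e v u) (x u))"
    using fin by (subst sum.insert; (subst sum.union_disjoint)?; (subst sum.union_disjoint)?)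
      (auto simp: ij L_def D_def B_def)
  moreover define c where "c = \<eta>r i - \<eta>c (Suc j)"
  ultimately have c: "single (?e v v) (x v) + (\<Sum>u\<in>L. single (?e v u) (x u))
      + (\<Sum>u\<in>D. single (?e v u) (x u)) - single (single v 1) c \<in> I"
    by (simp add: c_def single_diff algebra_simps)
  define F where "F = single (?e v v) (x v) + (\<Sum>u\<in>L. single (?e v u) (x u))
      + (\<Sum>u\<in>D. single (?e v u) (x u)) - single (single v 1) c"
  define d where "d = \<eta>c j - \<eta>c (Suc j)"
  define G where "G w = single (?e w v) (x v) + (\<Sum>u\<in>D. single (?e w u) (x u)) - single (single w 1) d" for w
  have G: "G w \<in> I" if "w \<in> L" for w
  proof -
    have "(\<Sum>u\<in>insert v D. single (?e w u) (x u)) - single (single w 1) d \<in> I"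
      unfolding d_def
      by (rule X_mult_form_mem[OF _ _ _ col_form_mem])
        (use v that in \<open>auto simp: ij L_def D_def antidiagonal_def\<close>)
    then show ?thesis using fin by (simp add: G_def D_def ij)
  qed
  \<comment> \<open>In \<open>F\<close> the product of \<open>w\<close> and \<open>v\<close> has
    coefficient \<open>x w\<close>, in \<open>G w\<close> it has \<open>x v\<close>.
    Cross-multiplying cancels it without division, whence the square in the leading
    coefficient.\<close>
  define f where "f = const (x v) * F - (\<Sum>w\<in>L. const (x w) * G w)"
  have "f \<in> I"
    unfolding f_def F_def
    by (intro ideal_diff const_mult_mem v c ideal_sum G) (use sub in auto)
  moreover have "f - single (?e v v) (x v ^ 2) = (\<Sum>u\<in>D. single (?e v u) (x v * x u)) - single (single v 1) (x v * c)
      - (\<Sum>w\<in>L. (\<Sum>u\<in>D. single (?e w u) (x w * x u)) - single (single w 1) (x w * d))"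
    unfolding f_def F_def G_def
    by (simp add: distrib_left right_diff_distrib sum_distrib_left const_mult_single power2_eq_square
        sum.distrib sum_subtractf add.commute mult.commute)
  moreover have "\<dots> \<in> lower_polys A (?e v v)"
  proof (intro lower_polys_diff lower_polys_sum lower_polys_single)
    fix u assume u: "u \<in> D"
    then show "less_rev (?e v u) (?e v v)"
      by (intro less_rev_add less_rev_single) (cases u, auto simp: D_def ij)
    \<comment> \<open>These products come from subtracting the \<open>G w\<close>. Since
      \<open>u\<close> lies beyond \<open>v\<close> in its column, it is a smaller variable than
      \<open>v\<close> and \<open>w\<close>.\<close>
    show "less_rev (?e w u) (?e v v)" if "w \<in> L" for w
    proof -
      obtain k m where "u = (k, j)" "i < k" "w = (i, m)" "m < j"
        using u \<open>w \<in> L\<close> by (cases u; cases w) (auto simp: D_def L_def)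
      then show ?thesis
        by (intro less_rev_smallest_var[of _ _ u]) (auto simp: ij mdeg_add keys_add_nat)
    qed
    show "keys (?e v u) \<subseteq> A" "\<And>w. w \<in> L \<Longrightarrow> keys (?e w u) \<subseteq> A"
      using u sub v by (auto simp: keys_add_nat)
  qed (use v sub in \<open>auto simp: mdeg_add intro!: less_rev_degree\<close>)
  ultimately have "f - single (?e v v) (x v ^ 2) \<in> lower_polys A (?e v v)"
    by (simp only:)
  with \<open>f \<in> I\<close> v show ?thesis
    unfolding reducible_def by blast
qed

lemma reducible_antidiagonal:
  assumes "v \<in> A" "w \<in> A" "antidiagonal v w"
  shows "reducible (single v 1 + single w 1)"
  unfolding reducible_def
  by (intro bexI[OF _ antidiagonal_mem[OF assms]] bexI[OF _ assms(1)] exI[of _ 0])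
    (simp add: X_mult_X)

lemma reducible_mult:
  assumes "reducible u" "keys m \<subseteq> A" "m = t + u"
  shows "reducible m"
proof -
  obtain f v e where f: "f \<in> I" "v \<in> A" "f - single u (x v ^ e) \<in> lower_polys A u"
    using assms(1) by (auto simp: reducible_def)
  have t: "keys t \<subseteq> A" using assms by (simp add: keys_add_nat)
  have "single t 1 * (f - single u (x v ^ e)) \<in> lower_polys A m"
    unfolding assms(3) using f(3) t by (rule lower_polys_mult)
  moreover have "single t 1 * f \<in> I"
    using subring f(1) t by (intro ideal_mult single_in_polys) (auto simp: is_subring_def)
  ultimately show ?thesis
    unfolding reducible_def using f(2) assms(3) by (auto simp: right_diff_distrib mult_single)
qed

lemma reducible_single_factor:
  assumes "v \<in> keys m" "keys m \<subseteq> A" "reducible (single v 1)"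
  shows "reducible m"
proof (rule reducible_mult[OF assms(3,2)])
  show "m = m - single v 1 + single v 1"
    using assms(1) by (intro poly_mapping_eqI) (auto simp: lookup_add lookup_minus lookup_single in_keys_iff when_def)
qed

lemma reducible_two_factors:
  assumes "v \<in> keys m" "w \<in> keys m" "v \<noteq> w \<or> lookup m v \<noteq> 1" "keys m \<subseteq> A"
    and "reducible (single v 1 + single w 1)"
  shows "reducible m"
proof (rule reducible_mult[OF assms(5,4)])
  show "m = m - (single v 1 + single w 1) + (single v 1 + single w 1)"
    using assms(1-3)
    by (intro poly_mapping_eqI) (auto simp: lookup_add lookup_minus lookup_single in_keys_iff when_def)
qed

lemma reducible_nonstandard:
  assumes m: "keys m \<subseteq> A" and ns: "m \<notin> std_exponents A"
  shows "reducible m"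
proof -
  consider (inner) v where "v \<in> keys m" "v \<notin> inner_points A"
    | (square) v where "v \<in> keys m" "lookup m v \<noteq> 1"
    | (pair) v w where "v \<in> keys m" "w \<in> keys m" "v \<noteq> w" "\<not> strictly_below v w" "\<not> strictly_below w v"
    using ns unfolding std_exponents_def by blast
  then show ?thesis
  proof cases
    case inner
    then have "v = (fst v, j_sharp A (fst v)) \<or> v = (i_flat A (snd v), snd v)"
      using m by (auto simp: inner_points_def prod_eq_iff)
    then have "reducible (single v 1)"
      using reducible_sharp[of "fst v"] reducible_flat[of "snd v"] inner(1) m by (metis subsetD)
    then show ?thesis using inner m reducible_single_factor by blast
  next
    case square
    then show ?thesis using m reducible_two_factors reducible_square by blast
  next
    case pair
    obtain i j k l where eq: "v = (i, j)" "w = (k, l)" by fastforce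
    have mem: "(i, j) \<in> A" "(k, l) \<in> A" using pair m eq by auto
    consider "i < k" "l < j" | "k < i" "j < l" | "i = k" "j < l" | "i = k" "l < j"
      | "j = l" "i < k" | "j = l" "k < i"
      using pair by (fastforce simp: eq strictly_below_def not_less le_less)
    then have "reducible (single v 1 + single w 1)"
    proof cases
      case 1
      then show ?thesis using reducible_antidiagonal[OF mem] by (simp add: eq antidiagonal_def)
    next
      case 2
      then show ?thesis using reducible_antidiagonal[OF mem(2,1)] by (simp add: eq antidiagonal_def add.commute)
    next
      case 3
      then show ?thesis using reducible_same_row mem by (simp add: eq)
    next
      case 4
      then show ?thesis using reducible_same_row[of i l j] mem by (simp add: eq add.commute)
    next
      case 5
      then show ?thesis using reducible_same_col mem by (simp add: eq)
    next
      case 6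
      then show ?thesis using reducible_same_col[of k j i] mem by (simp add: eq add.commute)
    qed
    then show ?thesis using pair m reducible_two_factors by blast
  qed
qed

end

section \<open>Lattice paths\<close>

text \<open>A path is given by the row \<open>r t\<close> of its point with coordinate sum \<open>t\<close>.\<close>

definition lattice_paths :: "(nat \<times> nat) set \<Rightarrow> nat \<Rightarrow> nat \<Rightarrow> (nat \<Rightarrow> nat) set" where
  "lattice_paths A p q = {r. r 0 = 0 \<and> (\<forall>t<p + q. r (Suc t) = r t \<or> r (Suc t) = Suc (r t)) \<and>
     (\<forall>t\<le>p + q. r t \<le> t \<and> (r t, t - r t) \<in> A) \<and> (\<forall>t>p + q. r t = 0)}"

lemma unit_step_mono:
  fixes g :: "nat \<Rightarrow> nat"
  assumes "\<And>t. t < N \<Longrightarrow> g (Suc t) = g t \<or> g (Suc t) = Suc (g t)" "s \<le> t" "t \<le> N"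
  shows "g s \<le> g t"
  using assms(2,3)
proof (induction t rule: dec_induct)
  case (step t)
  then show ?case using assms(1)[of t] by auto
qed simp

text \<open>A path enters each row or column once and for all, so its points at or beyond a given
  row or column form a final segment.\<close>

lemma unit_step_threshold:
  fixes g :: "nat \<Rightarrow> nat"
  assumes g0: "g 0 = 0" and step: "\<And>t. t < N \<Longrightarrow> g (Suc t) = g t \<or> g (Suc t) = Suc (g t)"
    and i: "0 < i" "i \<le> g N"
  obtains s where "s < N" "g (Suc s) = i" "Suc (g s) = i" "\<And>t. t \<le> N \<Longrightarrow> i \<le> g t \<longleftrightarrow> Suc s \<le> t"
proof -
  define s' where "s' = (LEAST t. i \<le> g t)"
  have s': "i \<le> g s'" "s' \<le> N"
    using i(2) unfolding s'_def by (auto intro: LeastI Least_le)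
  have below: "g t < i" if "t < s'" for t
    using not_less_Least[of t "\<lambda>t. i \<le> g t"] that by (auto simp: s'_def)
  obtain s where s: "s' = Suc s" using s' g0 i(1) by (cases s') auto
  show ?thesis
  proof
    show "s < N" using s' s by simp
    show "g (Suc s) = i" "Suc (g s) = i"
      using step[of s] s' s below[of s] by auto
    show "i \<le> g t \<longleftrightarrow> Suc s \<le> t" if "t \<le> N" for t
    proof
      assume "i \<le> g t"
      then show "Suc s \<le> t" using below[of t] s by (cases "t < s'") auto
    next
      assume "Suc s \<le> t"
      then have "g s' \<le> g t"
        using that s by (intro unit_step_mono[where N = N and g = g, OF step]) auto
      then show "i \<le> g t" using s'(1) by simp
    qed
  qed
qed

context lattice_region
begin

lemma finite_lattice_paths: "finite (lattice_paths A p q)"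
proof (rule finite_subset)
  show "lattice_paths A p q \<subseteq> {r. \<forall>t. (t \<in> {..p + q} \<longrightarrow> r t \<in> {..p}) \<and> (t \<notin> {..p + q} \<longrightarrow> r t = 0)}"
    using bounded by (auto simp: lattice_paths_def)
  show "finite {r. \<forall>t. (t \<in> {..p + q} \<longrightarrow> r t \<in> {..p}) \<and> (t \<notin> {..p + q} \<longrightarrow> r t = (0::nat))}"
    by (rule finite_set_of_finite_funs) auto
qed

lemma finite_std_exponents: "finite (std_exponents A)"
  and inj_on_keys_std_exponents: "inj_on keys (std_exponents A)"
proof -
  show inj: "inj_on keys (std_exponents A)"
  proof (rule inj_onI, rule poly_mapping_eqI)
    fix m n :: "nat \<times> nat \<Rightarrow>\<^sub>0 nat" and v
    assume "m \<in> std_exponents A" "n \<in> std_exponents A" "keys m = keys n"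
    then show "lookup m v = lookup n v"
      unfolding std_exponents_def by (cases "v \<in> keys n") (auto simp: not_in_keys_iff_lookup_eq_zero)
  qed
  have "keys ` std_exponents A \<subseteq> Pow A"
    by (auto simp: std_exponents_def inner_points_def)
  then have "finite (keys ` std_exponents A)"
    using finite_region finite_subset by blast
  then show "finite (std_exponents A)"
    using inj finite_imageD by blast
qed

text \<open>Inner points are upper corners of unit squares inside \<open>A\<close>: convexity of the
  row and of the column gives two corners, \<open>rect\<close> applied to these gives the
  last.\<close>

lemma inner_points_neighbours:
  assumes "(i, j) \<in> inner_points A"
  shows "0 < i" "0 < j" "(i, j) \<in> A" "(i - 1, j) \<in> A" "(i, j - 1) \<in> A" "(i - 1, j - 1) \<in> A"
proof -
  show A: "(i, j) \<in> A" using assms by (simp add: inner_points_def)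
  have sharp: "(i, j_sharp A i) \<in> A" "j_sharp A i < j"
    using A assms LeastI[of "\<lambda>j. (i, j) \<in> A" j] Least_le[of "\<lambda>j. (i, j) \<in> A" j]
    by (auto simp: inner_points_def j_sharp_def)
  have flat: "(i_flat A j, j) \<in> A" "i_flat A j < i"
    using A assms LeastI[of "\<lambda>i. (i, j) \<in> A" i] Least_le[of "\<lambda>i. (i, j) \<in> A" i]
    by (auto simp: inner_points_def i_flat_def)
  show "0 < i" "0 < j" using sharp flat by auto
  show "(i, j - 1) \<in> A" using rect[OF A sharp(1), of i "j - 1"] sharp(2) by auto
  show "(i - 1, j) \<in> A" using rect[OF flat(1) A, of "i - 1" j] flat(2) by auto
  then show "(i - 1, j - 1) \<in> A"
    using rect[OF _ \<open>(i, j - 1) \<in> A\<close>, of "i - 1" j "i - 1" "j - 1"] by auto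
qed

end

text \<open>A standard exponent with support \<open>T\<close> gives the path that goes up (in the second coordinate)
  whenever this keeps it out of the region \<open>{(i, j). i < k \<and> l \<le> j}\<close> for all \<open>(k, l) \<in> T\<close>.  It turns from
  right to up at \<open>(k, l - 1)\<close>, and \<open>T\<close> can be read off these turns.\<close>

locale std_support = lattice_region +
  fixes T :: "(nat \<times> nat) set"
  assumes inner: "T \<subseteq> inner_points A"
    and chain: "v \<in> T \<Longrightarrow> w \<in> T \<Longrightarrow> v \<noteq> w \<Longrightarrow> strictly_below v w \<or> strictly_below w v"
begin

definition allowed :: "(nat \<times> nat) set" where
  "allowed = {v\<in>A. \<forall>w\<in>T. \<not> (fst v < fst w \<and> snd w \<le> snd v)}"

primrec greedy :: "nat \<Rightarrow> nat" where
  "greedy 0 = 0"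
| "greedy (Suc t) = (if (greedy t, Suc t - greedy t) \<in> allowed then greedy t else Suc (greedy t))"

text \<open>A step right never becomes forbidden. If it leaves \<open>A\<close>, the step up stays
  in \<open>A\<close>, and a point \<open>w\<close> of \<open>T\<close> forbidding it would lie in
  the column being entered; the neighbour of \<open>w\<close> in the column before would then force
  the step right into \<open>A\<close>.\<close>

lemma allowed_step:
  assumes "(i, j) \<in> allowed" "(i, j) \<noteq> (p, q)"
  shows "(Suc i, j) \<in> allowed \<or> (i, Suc j) \<in> allowed"
proof -
  have A: "(i, j) \<in> A" using assms by (simp add: allowed_def)
  show ?thesis
  proof (cases "(Suc i, j) \<in> A")
    case True
    then show ?thesis using assms by (auto simp: allowed_def)
  next
    case False
    then have up: "(i, Suc j) \<in> A" using step[OF A] assms by blast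
    have "\<not> (i < fst w \<and> snd w \<le> Suc j)" if "w \<in> T" for w
    proof
      assume *: "i < fst w \<and> snd w \<le> Suc j"
      then have w: "snd w = Suc j" using assms that by (force simp: allowed_def)
      then have "(fst w, Suc j) \<in> inner_points A"
        using inner that by (metis prod.collapse subsetD)
      from inner_points_neighbours(5)[OF this] have "(fst w, j) \<in> A" by simp
      then have "(Suc i, j) \<in> A" using rect[OF A, of "fst w" j "Suc i" j] * by auto
      then show False using False by simp
    qed
    then show ?thesis using up by (auto simp: allowed_def)
  qed
qed

lemma greedy_allowed: "t \<le> p + q \<Longrightarrow> greedy t \<le> t \<and> (greedy t, t - greedy t) \<in> allowed"
proof (induction t)
  case 0
  have "0 < snd w" if "w \<in> T" for w
    using inner_points_neighbours(2)[of "fst w" "snd w"] inner that by auto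
  then show ?case using origin by (auto simp: allowed_def)
next
  case (Suc t)
  then have IH: "greedy t \<le> t" "(greedy t, t - greedy t) \<in> allowed" by auto
  have "(greedy t, t - greedy t) \<noteq> (p, q)" using Suc.prems IH by auto
  from allowed_step[OF IH(2) this] show ?case
    using IH(1) by (auto simp: Suc_diff_le)
qed

lemma allowed_convex:
  assumes "(i, j) \<in> allowed" "(k, l) \<in> allowed" "i < k" "l < j"
  shows "(k - 1, Suc l) \<in> allowed"
proof -
  have "(k - 1, Suc l) \<in> A"
    using assms rect[of i j k l "k - 1" "Suc l"] by (auto simp: allowed_def)
  then show ?thesis using assms by (fastforce simp: allowed_def)
qed

text \<open>An allowed point further up-left would, by \<open>allowed_convex\<close>, make the
  neighbour of the current path point allowed too, against the induction hypothesis.\<close>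

lemma greedy_least: "(k, l) \<in> allowed \<Longrightarrow> k + l = t \<Longrightarrow> t \<le> p + q \<Longrightarrow> greedy t \<le> k"
proof (induction t arbitrary: k l)
  case (Suc t)
  let ?i = "greedy t"
  have i: "?i \<le> t" "(?i, t - ?i) \<in> allowed" using greedy_allowed Suc.prems by auto
  have "\<not> k < ?i"
  proof
    assume "k < ?i"
    then have "(?i - 1, Suc (t - ?i)) \<in> allowed"
      using allowed_convex[OF Suc.prems(1) i(2)] i(1) Suc.prems(2) by auto
    from Suc.IH[OF this] show False using \<open>k < ?i\<close> i(1) Suc.prems(3) by auto
  qed
  moreover have "l = Suc t - k" using Suc.prems(2) by simp
  then have "k \<noteq> ?i" if "(?i, Suc t - ?i) \<notin> allowed"
    using that Suc.prems(1) by blast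
  ultimately show ?case by (auto simp: not_less le_less)
qed simp

text \<open>Every point of the same coordinate sum with smaller first coordinate is forbidden by
  \<open>w\<close>, so the greedy path has to pass through \<open>(k, l)\<close>.\<close>

lemma greedy_hits:
  assumes "(k, l) \<in> allowed" "w \<in> T" "k \<le> fst w" "snd w \<le> Suc l" "k + l \<le> p + q"
  shows "greedy (k + l) = k"
proof (rule ccontr)
  assume "greedy (k + l) \<noteq> k"
  then have "greedy (k + l) < k" using greedy_least[OF assms(1) refl assms(5)] by simp
  then show False
    using greedy_allowed[OF assms(5)] assms by (force simp: allowed_def)
qed

lemma corners_allowed:
  assumes "(Suc i, Suc j) \<in> T"
  shows "(i, j) \<in> allowed" "(Suc i, j) \<in> allowed" "(Suc i, Suc j) \<in> allowed"
proof -
  have "(Suc i, Suc j) \<in> inner_points A" using assms inner by auto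
  note A = inner_points_neighbours[OF this]
  have "\<not> (i < fst w \<and> snd w \<le> j) \<and> \<not> (Suc i < fst w \<and> snd w \<le> Suc j)" if "w \<in> T" for w
    using chain[OF that assms] by (cases w) (auto simp: strictly_below_def)
  then show "(i, j) \<in> allowed" "(Suc i, j) \<in> allowed" "(Suc i, Suc j) \<in> allowed"
    using A by (auto simp: allowed_def Suc_le_eq)
qed

text \<open>Membership of \<open>(i, Suc j)\<close> in \<open>A\<close> separates turns caused by
  \<open>T\<close> from those forced by the boundary of \<open>A\<close>.\<close>

lemma support_eq_turns:
  "T = {(Suc i, Suc j) | i j. i + j + 2 \<le> p + q \<and> greedy (i + j) = i \<and> greedy (i + j + 1) = Suc i \<and>
     greedy (i + j + 2) = Suc i \<and> (i, Suc j) \<in> A}" (is "T = ?S")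
proof (intro set_eqI iffI)
  fix w assume w: "w \<in> T"
  then have "w \<in> inner_points A" using inner by blast
  then obtain i j where ij: "w = (Suc i, Suc j)"
    using inner_points_neighbours(1,2) by (metis Suc_pred prod.collapse)
  note A = inner_points_neighbours[OF \<open>w \<in> inner_points A\<close>[unfolded ij]]
  have le: "i + j + 2 \<le> p + q" using bounded[OF A(3)] by simp
  note C = corners_allowed[OF w[unfolded ij]]
  have "greedy (i + j) = i" "greedy (Suc i + j) = Suc i" "greedy (Suc i + Suc j) = Suc i"
    using greedy_hits[OF C(1) w] greedy_hits[OF C(2) w] greedy_hits[OF C(3) w] le
    unfolding ij by (simp_all del: greedy.simps)
  then show "w \<in> ?S"
    using A(4) le by (auto simp: ij simp del: greedy.simps)
next
  fix w assume "w \<in> ?S"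
  then obtain i j where w: "w = (Suc i, Suc j)" and le: "i + j + 2 \<le> p + q"
    and g: "greedy (i + j) = i" "greedy (Suc (i + j)) = Suc i" "greedy (Suc (Suc (i + j))) = Suc i"
    and A: "(i, Suc j) \<in> A" by (auto simp del: greedy.simps)
  \<comment> \<open>The path went right although up was inside \<open>A\<close>, so some
    \<open>u\<close> in \<open>T\<close> blocked it. The allowed points \<open>(i, j)\<close> and
    \<open>(Suc i, Suc j)\<close> leave only one position for \<open>u\<close>.\<close>
  have "(i, Suc j) \<notin> allowed"
    using g(1,2) by (auto simp: Suc_diff_le split: if_splits)
  then obtain u where u: "u \<in> T" "i < fst u" "snd u \<le> Suc j"
    using A by (auto simp: allowed_def)
  have "(i, j) \<in> allowed" "(Suc i, Suc j) \<in> allowed"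
    using greedy_allowed[of "i + j"] greedy_allowed[of "Suc (Suc (i + j))"] le g
    by (auto simp del: greedy.simps)
  then have "u = (Suc i, Suc j)"
    using u by (cases u) (force simp: allowed_def)
  then show "w \<in> T" using u w by simp
qed

end

context lattice_region
begin

lemma card_std_exponents_le: "card (std_exponents A) \<le> card (lattice_paths A p q)"
proof -
  \<comment> \<open>Values after \<open>p + q\<close> are reset to 0, the normal form in which a
    path is a unique function.\<close>
  define G where "G m t = (if t \<le> p + q then std_support.greedy A (keys m) t else 0)"
    for m :: "nat \<times> nat \<Rightarrow>\<^sub>0 nat" and t
  define turns where "turns r = {(Suc i, Suc j) | i j. i + j + 2 \<le> p + q \<and> r (i + j) = i \<and>
    r (i + j + 1) = Suc i \<and> r (i + j + 2) = Suc i \<and> (i, Suc j) \<in> A}" for r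
  have supp: "std_support A p q (keys m)" if "m \<in> std_exponents A" for m
    using that lattice_region_axioms
    by (auto simp: std_support_def std_support_axioms_def std_exponents_def)
  have turns: "turns (G m) = keys m" if "m \<in> std_exponents A" for m
  proof -
    interpret std_support A p q "keys m" by (rule supp[OF that])
    show ?thesis
      by (subst support_eq_turns) (auto simp: turns_def G_def simp del: greedy.simps)
  qed
  have "inj_on G (std_exponents A)"
    using inj_on_keys_std_exponents turns by (metis inj_on_def)
  moreover have "G ` std_exponents A \<subseteq> lattice_paths A p q"
  proof (rule image_subsetI)
    fix m assume m: "m \<in> std_exponents A"
    interpret std_support A p q "keys m" by (rule supp[OF m])
    show "G m \<in> lattice_paths A p q"
      using greedy_allowed by (auto simp: lattice_paths_def G_def allowed_def)
  qed
  ultimately show ?thesis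
    using finite_lattice_paths card_inj_on_le by blast
qed

end

section \<open>Evaluation along lattice paths\<close>

lemma sum_indicator_mult:
  "finite S \<Longrightarrow> m \<in> S \<Longrightarrow> (\<Sum>s\<in>S. (if s = m then 1 else 0) * F s) = (F m :: 'r::comm_ring_1)"
  by (simp add: if_distrib[of "\<lambda>x. x * _"] cong: if_cong)

lemma of_nat_ratfun_eq_iff: "(of_nat m :: ratfun) = of_nat n \<longleftrightarrow> m = n"
proof -
  have "(of_nat k :: ratfun) = to_fract (of_nat k)" for k
    by (induction k) simp_all
  then show ?thesis by simp
qed

text \<open>The right-hand sides \<open>\<eta>\<close> are perturbed in a direction with pairwise distinct entries,
  the perturbation parameter being the polynomial variable \<open>[:0, 1:]\<close>.  Along a path
  the forms \<open>\<theta>\<close> are the tail sums of \<open>\<xi> v * X v\<close>, so that the perturbed system has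
  exactly one solution \<open>path_point r\<close> supported on a given path \<open>r\<close>, and this
  solution vanishes nowhere on the path.\<close>

locale path_evaluation = lattice_region +
  fixes \<eta>r \<eta>c :: "nat \<Rightarrow> ratfun"
  assumes eta_zero: "\<eta>r 0 = \<eta>c 0"
begin

text \<open>The perturbation weights are 1, ..., p + 1 for rows and p + 2, ..., p + q + 1 for the
  columns from 1 on. Column 0 shares weight 1 with row 0 because both forms sum over all of
  \<open>A\<close>.\<close>

definition row_value :: "nat \<Rightarrow> ratfun poly" where
  "row_value i = (if i \<le> p then [:\<eta>r i, of_nat (Suc i):] else 0)"

definition col_value :: "nat \<Rightarrow> ratfun poly" where
  "col_value j = (if j \<le> q then [:\<eta>c j, of_nat (if j = 0 then 1 else Suc (p + j)):] else 0)"

text \<open>The value prescribed for the sum over the path from its point \<open>t\<close> on. After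
  a step up these points are the ones from a certain column on, after a step right the ones from a
  certain row on.\<close>

definition tail :: "(nat \<Rightarrow> nat) \<Rightarrow> nat \<Rightarrow> ratfun poly" where
  "tail r t = (if t = 0 then row_value 0 else if t > p + q then 0
     else if r t = r (t - 1) then col_value (t - r t) else row_value (r t))"

definition path_point :: "(nat \<Rightarrow> nat) \<Rightarrow> nat \<times> nat \<Rightarrow> ratfun poly" where
  "path_point r v = (let t = fst v + snd v in
     if t \<le> p + q \<and> r t = fst v then [:inverse (\<xi> v):] * (tail r t - tail r (Suc t)) else 0)"

abbreviation "paths \<equiv> lattice_paths A p q"

lemma path_facts:
  assumes "r \<in> paths"
  shows "r 0 = 0" and "t < p + q \<Longrightarrow> r (Suc t) = r t \<or> r (Suc t) = Suc (r t)"
    and "t \<le> p + q \<Longrightarrow> r t \<le> t" and "t \<le> p + q \<Longrightarrow> (r t, t - r t) \<in> A"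
    and "r (p + q) = p"
proof -
  show "r 0 = 0" "t < p + q \<Longrightarrow> r (Suc t) = r t \<or> r (Suc t) = Suc (r t)"
    "t \<le> p + q \<Longrightarrow> r t \<le> t" "t \<le> p + q \<Longrightarrow> (r t, t - r t) \<in> A"
    using assms by (auto simp: lattice_paths_def)
  have "(r (p + q), p + q - r (p + q)) \<in> A" using assms by (simp add: lattice_paths_def)
  from bounded[OF this] show "r (p + q) = p" by auto
qed

lemma path_col_step:
  assumes "r \<in> paths" "t < p + q"
  shows "Suc t - r (Suc t) = t - r t \<or> Suc t - r (Suc t) = Suc (t - r t)"
  using path_facts(2,3)[OF assms(1), of t] assms(2) by auto

lemma path_mono:
  assumes r: "r \<in> paths" and "s \<le> t" "t \<le> p + q"
  shows "r s \<le> r t" "s - r s \<le> t - r t"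
  using unit_step_mono[where g = r and N = "p + q", OF path_facts(2)[OF r] assms(2,3)]
    unit_step_mono[where g = "\<lambda>t. t - r t" and N = "p + q", OF path_col_step[OF r] assms(2,3)]
  by auto

lemma sum_over_path:
  assumes r: "r \<in> paths"
  shows "(\<Sum>v\<in>{v\<in>A. Q v}. [:\<xi> v:] * path_point r v)
    = (\<Sum>t\<in>{t. t \<le> p + q \<and> Q (r t, t - r t)}. tail r t - tail r (Suc t))"
proof -
  let ?T = "{t. t \<le> p + q \<and> Q (r t, t - r t)}"
  let ?n = "\<lambda>t. (r t, t - r t)"
  have sum: "r t + (t - r t) = t" if "t \<le> p + q" for t
    using path_facts(3)[OF r that] by simp
  have "(\<Sum>v\<in>{v\<in>A. Q v}. [:\<xi> v:] * path_point r v) = (\<Sum>v\<in>?n ` ?T. [:\<xi> v:] * path_point r v)"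
  proof (rule sum.mono_neutral_right)
    show "finite {v\<in>A. Q v}" using finite_region by simp
    show "?n ` ?T \<subseteq> {v\<in>A. Q v}" using path_facts(4)[OF r] by auto
    show "\<forall>v\<in>{v\<in>A. Q v} - ?n ` ?T. [:\<xi> v:] * path_point r v = 0"
    proof
      fix v assume v: "v \<in> {v\<in>A. Q v} - ?n ` ?T"
      obtain i j where ij: "v = (i, j)" by fastforce
      have "\<not> (i + j \<le> p + q \<and> r (i + j) = i)"
      proof
        assume *: "i + j \<le> p + q \<and> r (i + j) = i"
        then have "v = ?n (i + j)" "i + j \<in> ?T" using v by (auto simp: ij)
        then show False using v by blast
      qed
      then show "[:\<xi> v:] * path_point r v = 0"
        by (auto simp: path_point_def ij)
    qed
  qed
  also have "\<dots> = (\<Sum>t\<in>?T. [:\<xi> (?n t):] * path_point r (?n t))"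
  proof (rule sum.reindex[unfolded comp_def], rule inj_onI)
    fix s t assume *: "s \<in> ?T" "t \<in> ?T" "?n s = ?n t"
    then have "r s + (s - r s) = r t + (t - r t)" by (metis prod.inject)
    moreover have "r s + (s - r s) = s" "r t + (t - r t) = t" using sum *(1,2) by auto
    ultimately show "s = t" by (simp only:)
  qed
  also have "\<dots> = (\<Sum>t\<in>?T. tail r t - tail r (Suc t))"
  proof (rule sum.cong[OF refl])
    fix t assume "t \<in> ?T"
    then show "[:\<xi> (?n t):] * path_point r (?n t) = tail r t - tail r (Suc t)"
      using sum xi_nonzero[of "?n t"] by (simp add: path_point_def flip: mult.assoc)
  qed
  finally show ?thesis .
qed

lemma sum_tail_differences:
  assumes "s \<le> p + q" and "\<And>t. t \<le> p + q \<Longrightarrow> R t \<longleftrightarrow> s \<le> t"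
  shows "(\<Sum>t\<in>{t. t \<le> p + q \<and> R t}. tail r t - tail r (Suc t)) = tail r s"
proof -
  have "{t. t \<le> p + q \<and> R t} = {s..p + q}" using assms by auto
  then have "(\<Sum>t\<in>{t. t \<le> p + q \<and> R t}. tail r t - tail r (Suc t)) = tail r s - tail r (Suc (p + q))"
    using sum_natinterval_diff[of "tail r" s "p + q"] assms(1) by simp
  then show ?thesis by (simp add: tail_def)
qed

lemma row_sum:
  assumes r: "r \<in> paths"
  shows "(\<Sum>v\<in>{v\<in>A. i \<le> fst v}. [:\<xi> v:] * path_point r v) = row_value i"
proof -
  consider "i = 0" | "0 < i" "i \<le> p" | "p < i" by linarith
  then show ?thesis
  proof cases
    case 1
    then show ?thesis
      unfolding sum_over_path[OF r] by (subst sum_tail_differences[of 0]) (auto simp: tail_def)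
  next
    case 2
    \<comment> \<open>Row \<open>i\<close> is entered by a step right, so the tail at
      \<open>Suc s\<close> is given by the row, not by the column.\<close>
    obtain s where s: "s < p + q" "r (Suc s) = i" "Suc (r s) = i"
      "\<And>t. t \<le> p + q \<Longrightarrow> i \<le> r t \<longleftrightarrow> Suc s \<le> t"
      using unit_step_threshold[where g = r and N = "p + q" and i = i, OF path_facts(1,2)[OF r]]
        path_facts(5)[OF r] 2 by auto
    then show ?thesis
      unfolding sum_over_path[OF r] by (subst sum_tail_differences[of "Suc s"]) (auto simp: tail_def)
  next
    case 3
    then have "{v\<in>A. i \<le> fst v} = {}" using bounded by fastforce
    then show ?thesis using 3 by (simp add: row_value_def del: Collect_empty_eq)
  qed
qed

lemma col_sum:
  assumes r: "r \<in> paths"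
  shows "(\<Sum>v\<in>{v\<in>A. j \<le> snd v}. [:\<xi> v:] * path_point r v) = col_value j"
proof -
  consider "j = 0" | "0 < j" "j \<le> q" | "q < j" by linarith
  then show ?thesis
  proof cases
    case 1
    then show ?thesis
      \<comment> \<open>Row 0 and column 0 prescribe the same total; this is where \<eta>r 0 =
        \<eta>c 0 enters.\<close>
      unfolding sum_over_path[OF r]
      by (subst sum_tail_differences[of 0]) (auto simp: tail_def row_value_def col_value_def eta_zero)
  next
    case 2
    obtain s where s: "s < p + q" "Suc s - r (Suc s) = j" "Suc (s - r s) = j"
      "\<And>t. t \<le> p + q \<Longrightarrow> j \<le> t - r t \<longleftrightarrow> Suc s \<le> t"
      using unit_step_threshold[where g = "\<lambda>t. t - r t" and N = "p + q" and i = j, OF _ path_col_step[OF r]]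
        path_facts(5)[OF r] 2 by auto
    have "r (Suc s) = r s"
      using s path_facts(2)[OF r s(1)] path_facts(3)[OF r, of s] by auto
    then show ?thesis
      unfolding sum_over_path[OF r] using s
      by (subst sum_tail_differences[of "Suc s"]) (auto simp: tail_def)
  next
    case 3
    then have "{v\<in>A. j \<le> snd v} = {}" using bounded by fastforce
    then show ?thesis using 3 by (simp add: col_value_def del: Collect_empty_eq)
  qed
qed

text \<open>Both coordinates increase weakly along a path, so its support contains no antidiagonal
  pair.\<close>

lemma path_point_antidiagonal:
  assumes r: "r \<in> paths" and vw: "antidiagonal v w"
  shows "path_point r v = 0 \<or> path_point r w = 0"
proof (rule ccontr)
  assume "\<not> ?thesis"
  then have *: "fst v + snd v \<le> p + q" "r (fst v + snd v) = fst v"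
    "fst w + snd w \<le> p + q" "r (fst w + snd w) = fst w"
    by (auto simp: path_point_def Let_def split: if_splits)
  show False
    using path_mono[OF r, of "fst v + snd v" "fst w + snd w"]
      path_mono[OF r, of "fst w + snd w" "fst v + snd v"] * vw
    by (cases "fst v + snd v \<le> fst w + snd w") (auto simp: antidiagonal_def)
qed

text \<open>The coefficient of \<epsilon> in \<open>tail\<close>, as a natural number, so that
  comparing consecutive tails is arithmetic.\<close>

definition slope :: "(nat \<Rightarrow> nat) \<Rightarrow> nat \<Rightarrow> nat" where
  "slope r t = (if t = 0 then 1 else if t > p + q then 0
     else if r t = r (t - 1) then Suc (p + (t - r t)) else Suc (r t))"

lemma coeff_tail:
  assumes r: "r \<in> paths" and t: "t \<le> Suc (p + q)"
  shows "coeff (tail r t) 1 = of_nat (slope r t)"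
proof (cases "t = 0 \<or> t > p + q")
  case True
  then show ?thesis by (auto simp: tail_def slope_def row_value_def)
next
  case False
  then have le: "r t \<le> p" "t - r t \<le> q" "r (t - 1) \<le> t - 1"
    using bounded[OF path_facts(4)[OF r, of t]] path_facts(3)[OF r, of "t - 1"] by auto
  show ?thesis
  proof (cases "r t = r (t - 1)")
    case True
    then have "t - r t \<noteq> 0" using le False by auto
    then show ?thesis using True False le by (simp add: tail_def slope_def col_value_def del: of_nat_Suc)
  next
    case False': False
    then show ?thesis using False le by (simp add: tail_def slope_def row_value_def del: of_nat_Suc)
  qed
qed

lemma slope_neq:
  assumes r: "r \<in> paths" and t: "t \<le> p + q"
  shows "slope r t \<noteq> slope r (Suc t)"
proof (cases "t = p + q")
  case True
  then show ?thesis by (auto simp: slope_def)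
next
  case False
  then have lt: "t < p + q" using t by simp
  have le: "r t \<le> p" "r (Suc t) \<le> p" "r t \<le> t" "r (Suc t) \<le> Suc t" "r 0 = 0" "r (t - 1) \<le> t - 1"
    using bounded[OF path_facts(4)[OF r, of t]] bounded[OF path_facts(4)[OF r, of "Suc t"]]
      path_facts(1)[OF r] path_facts(3)[OF r, of t] path_facts(3)[OF r, of "Suc t"]
      path_facts(3)[OF r, of "t - 1"] lt by auto
  have "slope r (Suc t) = (if r (Suc t) = r t then Suc (p + Suc (t - r t)) else Suc (Suc (r t)))"
    using path_facts(2)[OF r lt] lt le by (auto simp: slope_def Suc_diff_le)
  moreover have "slope r t = Suc (p + (t - r t)) \<and> 0 < t - r t \<or> slope r t = Suc (r t)"
    using lt le by (auto simp: slope_def)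
  ultimately show ?thesis
    using path_facts(2)[OF r lt] le by auto
qed

text \<open>The coefficient of \<epsilon> does not involve \<eta>, and consecutive tails carry
  different weights.\<close>

lemma path_point_nonzero:
  assumes r: "r \<in> paths" and t: "t \<le> p + q"
  shows "path_point r (r t, t - r t) \<noteq> 0"
proof -
  have "coeff (tail r t) 1 \<noteq> coeff (tail r (Suc t)) 1"
    using slope_neq[OF r t] coeff_tail[OF r, of t] coeff_tail[OF r, of "Suc t"] t
    by (simp add: of_nat_ratfun_eq_iff del: of_nat_Suc)
  then have "tail r t - tail r (Suc t) \<noteq> 0" by auto
  then show ?thesis
    using path_facts(3)[OF r t] t xi_nonzero[of "(r t, t - r t)"] by (simp add: path_point_def)
qed

section \<open>Monomials that separate the paths\<close>

definition path_monomial :: "(nat \<Rightarrow> nat) \<Rightarrow> (nat \<times> nat \<Rightarrow>\<^sub>0 nat)" where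
  "path_monomial r = (\<Sum>t\<le>p + q. single (r t, t - r t) 1)"

lemma path_monomial_keys: "r \<in> paths \<Longrightarrow> keys (path_monomial r) \<subseteq> A"
  unfolding path_monomial_def using path_facts(4)
  by (intro order_trans[OF keys_sum_subset]) auto

text \<open>A path has exactly one point of each coordinate sum up to \<open>p + q\<close>, so a
  support containing all points of \<open>r\<close> can only be that of \<open>r\<close>.\<close>

lemma meval_path_monomial:
  assumes r: "r \<in> paths" and r': "r' \<in> paths"
  shows "meval (path_point r') (path_monomial r) \<noteq> 0 \<longleftrightarrow> r' = r"
proof -
  have prod: "meval (path_point r') (path_monomial r) = (\<Prod>t\<le>p + q. path_point r' (r t, t - r t))"
    by (simp add: path_monomial_def meval_sum)
  show ?thesis
  proof
    assume "meval (path_point r') (path_monomial r) \<noteq> 0"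
    then have nz: "path_point r' (r t, t - r t) \<noteq> 0" if "t \<le> p + q" for t
      using that unfolding prod by auto
    show "r' = r"
    proof
      fix t
      show "r' t = r t"
      proof (cases "t \<le> p + q")
        case True
        then show ?thesis using nz[OF True] path_facts(3)[OF r True]
          by (auto simp: path_point_def split: if_splits)
      next
        case False
        then show ?thesis using r r' by (simp add: lattice_paths_def)
      qed
    qed
  next
    assume "r' = r"
    then show "meval (path_point r') (path_monomial r) \<noteq> 0"
      unfolding prod using path_point_nonzero[OF r] by simp
  qed
qed

section \<open>Expanding values in standard monomials\<close>

definition vanishing :: "(nat \<times> nat, ratfun poly) mpoly set" where
  "vanishing = {f. \<forall>r\<in>paths. peval (\<lambda>c. c) (path_point r) f = 0}"

text \<open>Congruence modulo this ideal is equality of values at all path points, so each reduction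
  over K[\<epsilon>] becomes an identity of values.\<close>

sublocale vanishing: reduction A p q UNIV "\<lambda>v. [:\<xi> v:]" row_value col_value vanishing
proof unfold_locales
  interpret coeff_hom "\<lambda>c. c :: ratfun poly" by (rule coeff_hom_id)
  show "is_ideal (polys UNIV A) vanishing"
    unfolding vanishing_def by (rule is_ideal_common_zeros)
  show "X v * X w \<in> vanishing" if "antidiagonal v w" for v w
    unfolding vanishing_def using path_point_antidiagonal[OF _ that] by (simp add: peval_mult)
  show "(\<Sum>v\<in>{v\<in>A. i \<le> fst v}. const [:\<xi> v:] * X v) - const (row_value i) \<in> vanishing" for i
    unfolding vanishing_def using row_sum[of _ i]
    by (simp add: peval_diff peval_sum peval_mult del: mult_pCons_left)
  show "(\<Sum>v\<in>{v\<in>A. j \<le> snd v}. const [:\<xi> v:] * X v) - const (col_value j) \<in> vanishing" for j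
    unfolding vanishing_def using col_sum[of _ j]
    by (simp add: peval_diff peval_sum peval_mult del: mult_pCons_left)
qed (auto simp: is_subring_UNIV)

text \<open>Division with remainder carried out on values. Its triangularity in the monomial order
  later allows the coefficient at an initial monomial to be read off.\<close>

lemma meval_standard_expansion:
  assumes "keys m \<subseteq> A"
  shows "\<exists>h. (\<forall>s. h s \<noteq> 0 \<longrightarrow> s = m \<or> less_rev s m) \<and> (m \<in> std_exponents A \<longrightarrow> h m = 1) \<and>
    (\<forall>r\<in>paths. meval (path_point r) m = (\<Sum>s\<in>std_exponents A. h s * meval (path_point r) s))"
  using finite_region assms
proof (induction rule: less_rev_induct)
  case (less m)
  interpret coeff_hom "\<lambda>c. c :: ratfun poly" by (rule coeff_hom_id)
  show ?case
  proof (cases "m \<in> std_exponents A")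
    case True
    then show ?thesis
      by (intro exI[of _ "\<lambda>s. if s = m then 1 else 0"] conjI ballI)
        (simp_all add: sum_indicator_mult finite_std_exponents)
  next
    case False
    then obtain f v e where f: "f \<in> vanishing" and v: "v \<in> A"
      and low: "f - single m ([:\<xi> v:] ^ e) \<in> lower_polys A m"
      using vanishing.reducible_nonstandard[OF less.hyps] unfolding vanishing.reducible_def by blast
    define g where "g = f - single m ([:\<xi> v:] ^ e)"
    \<comment> \<open>\<open>\<xi> v\<close> is a constant of K[\<epsilon>], so dividing by the
      leading coefficient creates no denominators in \<epsilon>.\<close>
    define c where "c = - ([:inverse (\<xi> v):] ^ e)"
    have unit: "c * [:\<xi> v:] ^ e = - 1"
      using xi_nonzero[of v] by (simp add: c_def pCons_one flip: power_mult_distrib)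
    have "\<forall>n\<in>keys g. \<exists>h. (\<forall>s. h s \<noteq> 0 \<longrightarrow> s = n \<or> less_rev s n) \<and>
      (\<forall>r\<in>paths. meval (path_point r) n = (\<Sum>s\<in>std_exponents A. h s * meval (path_point r) s))"
      using less.IH low unfolding g_def lower_polys_def by blast
    from bchoice[OF this] obtain H where H0: "\<forall>n\<in>keys g. (\<forall>s. H n s \<noteq> 0 \<longrightarrow> s = n \<or> less_rev s n) \<and>
      (\<forall>r\<in>paths. meval (path_point r) n = (\<Sum>s\<in>std_exponents A. H n s * meval (path_point r) s))"
      by (rule exE)
    have H: "\<And>n s. n \<in> keys g \<Longrightarrow> H n s \<noteq> 0 \<Longrightarrow> s = n \<or> less_rev s n"
      "\<And>n r. n \<in> keys g \<Longrightarrow> r \<in> paths \<Longrightarrow>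
         meval (path_point r) n = (\<Sum>s\<in>std_exponents A. H n s * meval (path_point r) s)"
      subgoal using H0 by fast
      subgoal using H0 by fast
      done
    define h where "h s = (\<Sum>n\<in>keys g. c * lookup g n * H n s)" for s
    have "s = m \<or> less_rev s m" if "h s \<noteq> 0" for s
    proof -
      from that obtain n where n: "n \<in> keys g" "H n s \<noteq> 0"
        unfolding h_def by (metis (no_types, lifting) mult_zero_right sum.neutral)
      then have "less_rev n m" using low by (simp add: g_def lower_polys_def)
      then show ?thesis using H(1)[OF n] less_rev_trans by blast
    qed
    moreover have "meval (path_point r) m = (\<Sum>s\<in>std_exponents A. h s * meval (path_point r) s)"
      if r: "r \<in> paths" for r
    proof -
      let ?z = "path_point r"
      have "peval (\<lambda>c. c) ?z g + [:\<xi> v:] ^ e * meval ?z m = 0"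
        using f r by (simp add: g_def peval_diff peval_single vanishing_def)
      then have "peval (\<lambda>c. c) ?z g = - ([:\<xi> v:] ^ e * meval ?z m)"
        by (rule eq_neg_iff_add_eq_0[THEN iffD2])
      then have "c * peval (\<lambda>c. c) ?z g = - ((c * [:\<xi> v:] ^ e) * meval ?z m)"
        by (simp only: mult_minus_right mult.assoc)
      then have "meval ?z m = c * peval (\<lambda>c. c) ?z g"
        by (simp only: unit mult_minus1 minus_minus)
      also have "\<dots> = (\<Sum>n\<in>keys g. \<Sum>s\<in>std_exponents A. c * lookup g n * H n s * meval ?z s)"
        unfolding peval_def using H(2)[OF _ r] by (simp add: sum_distrib_left mult.assoc)
      also have "\<dots> = (\<Sum>s\<in>std_exponents A. h s * meval ?z s)"
        by (subst sum.swap) (simp add: h_def sum_distrib_right)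
      finally show ?thesis .
    qed
    ultimately show ?thesis using False by blast
  qed
qed

text \<open>All other monomials of \<open>f\<close> lie below the initial one and expand into still
  smaller or equal ones, so nothing else contributes to its coefficient.\<close>

lemma peval_standard_expansion:
  assumes f: "f \<in> polys UNIV A"
  obtains h where
    "\<And>r. r \<in> paths \<Longrightarrow> peval (\<lambda>c. [:c:]) (path_point r) f = (\<Sum>s\<in>std_exponents A. h s * meval (path_point r) s)"
    "\<And>m. is_initial m f \<Longrightarrow> m \<in> std_exponents A \<Longrightarrow> h m = [:lookup f m:]"
proof -
  have "\<forall>n\<in>keys f. \<exists>h. (\<forall>s. h s \<noteq> 0 \<longrightarrow> s = n \<or> less_rev s n) \<and> (n \<in> std_exponents A \<longrightarrow> h n = 1) \<and>
    (\<forall>r\<in>paths. meval (path_point r) n = (\<Sum>s\<in>std_exponents A. h s * meval (path_point r) s))"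
    using f meval_standard_expansion by (simp add: polys_def)
  from bchoice[OF this] obtain H where H0: "\<forall>n\<in>keys f. (\<forall>s. H n s \<noteq> 0 \<longrightarrow> s = n \<or> less_rev s n) \<and>
    (n \<in> std_exponents A \<longrightarrow> H n n = 1) \<and>
    (\<forall>r\<in>paths. meval (path_point r) n = (\<Sum>s\<in>std_exponents A. H n s * meval (path_point r) s))"
    by (rule exE)
  have H: "\<And>n s. n \<in> keys f \<Longrightarrow> H n s \<noteq> 0 \<Longrightarrow> s = n \<or> less_rev s n"
    "\<And>n. n \<in> keys f \<Longrightarrow> n \<in> std_exponents A \<Longrightarrow> H n n = 1"
    "\<And>n r. n \<in> keys f \<Longrightarrow> r \<in> paths \<Longrightarrow>
       meval (path_point r) n = (\<Sum>s\<in>std_exponents A. H n s * meval (path_point r) s)"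
    subgoal using H0 by fast
    subgoal using H0 by fast
    subgoal using H0 by fast
    done
  define h where "h s = (\<Sum>n\<in>keys f. [:lookup f n:] * H n s)" for s
  show ?thesis
  proof
    fix r assume r: "r \<in> paths"
    have "peval (\<lambda>c. [:c:]) (path_point r) f
        = (\<Sum>n\<in>keys f. \<Sum>s\<in>std_exponents A. [:lookup f n:] * H n s * meval (path_point r) s)"
      unfolding peval_def using H(3)[OF _ r] by (simp add: sum_distrib_left mult.assoc del: mult_pCons_left)
    also have "\<dots> = (\<Sum>s\<in>std_exponents A. h s * meval (path_point r) s)"
      by (subst sum.swap) (simp add: h_def sum_distrib_right del: mult_pCons_left)
    finally show "peval (\<lambda>c. [:c:]) (path_point r) f = (\<Sum>s\<in>std_exponents A. h s * meval (path_point r) s)" .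
  next
    fix m assume m: "is_initial m f" "m \<in> std_exponents A"
    then have mf: "m \<in> keys f" by (simp add: is_initial_def)
    have "H n m = 0" if "n \<in> keys f - {m}" for n
      using that m(1) H(1)[of n m] less_rev_trans less_rev_irrefl unfolding is_initial_def by blast
    then have "h m = [:lookup f m:] * H m m"
      unfolding h_def using mf by (subst sum.remove[of _ m]) auto
    then show "h m = [:lookup f m:]" using H(2)[OF mf m(2)] by simp
  qed
qed

end

section \<open>Linear independence of the standard monomials\<close>

text \<open>By \<open>diag\<close> the columns indexed by \<open>S\<close> span all functions on
  \<Phi> over the fraction field. A relation involving \<open>s\<close> would let the others span
  alone, but they are fewer than \<open>card \<Phi>\<close>.\<close>

lemma square_relation_trivial:
  fixes M :: "'s \<Rightarrow> 'f \<Rightarrow> 'r::idom"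
  assumes fin: "finite S" "finite \<Phi>" and card: "card S \<le> card \<Phi>"
    and diag: "\<And>r. r \<in> \<Phi> \<Longrightarrow> \<exists>h d. d \<noteq> 0 \<and> (\<forall>r'\<in>\<Phi>. (\<Sum>s\<in>S. h s * M s r') = (if r' = r then d else 0))"
    and rel: "\<And>r. r \<in> \<Phi> \<Longrightarrow> (\<Sum>s\<in>S. e s * M s r) = 0"
    and s: "s \<in> S"
  shows "e s = 0"
proof (rule ccontr)
  assume nz: "e s \<noteq> 0"
  interpret V: vector_space "\<lambda>(c :: 'r fract) (f :: 'f \<Rightarrow> 'r fract) x. c * f x"
    by unfold_locales (auto simp: fun_eq_iff algebra_simps)
  \<comment> \<open>Extending by zero outside \<Phi> makes equality on \<Phi> equality of
    functions.\<close>
  define vec where "vec s = (\<lambda>r. if r \<in> \<Phi> then to_fract (M s r) else 0)" for s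
  define delta where "delta r = (\<lambda>r' :: 'f. if r' = r then 1 else 0 :: 'r fract)" for r
  have to_fract_sum: "to_fract (sum g T) = (\<Sum>x\<in>T. to_fract (g x))" for g :: "'s \<Rightarrow> 'r" and T
    by (induction T rule: infinite_finite_induct) auto
  have sum_apply: "sum g T r = (\<Sum>x\<in>T. g x r)" for g :: "'x \<Rightarrow> 'f \<Rightarrow> 'r fract" and T r
    by (induction T rule: infinite_finite_induct) auto
  have inj: "inj_on delta \<Phi>"
    by (rule inj_onI) (metis delta_def zero_neq_one)
  have indep: "V.independent (delta ` \<Phi>)"
  proof (rule V.independent_if_scalars_zero)
    show "finite (delta ` \<Phi>)" using fin by simp
    fix c v assume sum: "(\<Sum>v\<in>delta ` \<Phi>. (\<lambda>x. c v * v x)) = 0" and "v \<in> delta ` \<Phi>"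
    then obtain r where r: "r \<in> \<Phi>" "v = delta r" by blast
    have "0 = (\<Sum>r'\<in>\<Phi>. c (delta r') * delta r' r)"
      using fun_cong[OF sum, of r] inj by (simp add: sum_apply sum.reindex)
    also have "\<dots> = c v"
      using r fin by (simp add: delta_def if_distrib cong: if_cong)
    finally show "c v = 0" by simp
  qed
  have sub: "delta ` \<Phi> \<subseteq> V.span (vec ` (S - {s}))"
  proof
    fix v assume "v \<in> delta ` \<Phi>"
    then obtain r where r: "r \<in> \<Phi>" "v = delta r" by blast
    obtain h d where h: "d \<noteq> 0" "\<And>r'. r' \<in> \<Phi> \<Longrightarrow> (\<Sum>s\<in>S. h s * M s r') = (if r' = r then d else 0)"
      using diag[OF r(1)] by blast
    have v: "v = (\<Sum>s\<in>S. (\<lambda>x. (to_fract (h s) / to_fract d) * vec s x))"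
    proof
      fix r'
      show "v r' = (\<Sum>s\<in>S. (\<lambda>x. (to_fract (h s) / to_fract d) * vec s x)) r'"
      proof (cases "r' \<in> \<Phi>")
        case True
        have "(\<Sum>s\<in>S. (to_fract (h s) / to_fract d) * vec s r') = (\<Sum>s\<in>S. to_fract (h s * M s r')) / to_fract d"
          using True by (simp add: vec_def sum_divide_distrib)
        also have "\<dots> = (if r' = r then 1 else 0)"
          unfolding to_fract_sum[symmetric] h(2)[OF True] using h(1) by simp
        finally show ?thesis by (simp add: sum_apply r delta_def)
      next
        case False
        then show ?thesis using r by (auto simp: sum_apply vec_def delta_def)
      qed
    qed
    have mem: "vec s' \<in> V.span (vec ` (S - {s}))" if "s' \<in> S" for s'
    proof (cases "s' = s")
      case True
      have "vec s = (\<Sum>s'\<in>S - {s}. (\<lambda>x. (- to_fract (e s') / to_fract (e s)) * vec s' x))"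
      proof
        fix r
        show "vec s r = (\<Sum>s'\<in>S - {s}. (\<lambda>x. (- to_fract (e s') / to_fract (e s)) * vec s' x)) r"
        proof (cases "r \<in> \<Phi>")
          case True
          have "e s * M s r + (\<Sum>s'\<in>S - {s}. e s' * M s' r) = 0"
            using rel[OF True] fin s by (simp add: sum.remove)
          then have "to_fract (e s * M s r + (\<Sum>s'\<in>S - {s}. e s' * M s' r)) = 0"
            by simp
          then have "to_fract (e s) * vec s r + (\<Sum>s'\<in>S - {s}. to_fract (e s') * vec s' r) = 0"
            using True by (simp add: to_fract_sum vec_def)
          then have "to_fract (e s) * vec s r = - (\<Sum>s'\<in>S - {s}. to_fract (e s') * vec s' r)"
            by (simp add: eq_neg_iff_add_eq_0)
          then have "vec s r = - (\<Sum>s'\<in>S - {s}. to_fract (e s') * vec s' r) / to_fract (e s)"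
            using nz by (simp add: field_simps)
          then show ?thesis
            by (simp add: sum_apply sum_negf sum_divide_distrib)
        qed (simp add: vec_def sum_apply)
      qed
      also have "\<dots> \<in> V.span (vec ` (S - {s}))"
        by (intro V.span_sum V.span_scale V.span_base) auto
      finally show ?thesis using True by simp
    qed (use that in \<open>auto intro: V.span_base\<close>)
    show "v \<in> V.span (vec ` (S - {s}))"
      unfolding v by (intro V.span_sum V.span_scale mem)
  qed
  have "finite (vec ` (S - {s}))" using fin by simp
  then have "card (delta ` \<Phi>) \<le> card (vec ` (S - {s}))"
    using indep sub by (rule V.independent_span_bound[THEN conjunct2])
  \<comment> \<open>Different indices may give the same vector, so this is only an
    inequality.\<close>
  also have "\<dots> \<le> card (S - {s})"
    using fin by (intro card_image_le) auto
  also have "\<dots> < card S"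
    using fin s by (intro card_Diff1_less) auto
  finally show False
    using card card_image[OF inj] by simp
qed

context path_evaluation
begin

text \<open>Subtracting \<epsilon> times the expansion of \<open>g\<close> from that of
  \<open>f\<close> gives a relation among standard monomials, so every \<open>h s\<close> is
  divisible by \<epsilon>.\<close>

lemma no_standard_initial:
  assumes f: "f \<in> polys UNIV A" and g: "g \<in> polys UNIV A"
    and eq: "\<And>r. r \<in> paths \<Longrightarrow> peval (\<lambda>c. [:c:]) (path_point r) f = [:0, 1:] * peval (\<lambda>c. [:c:]) (path_point r) g"
    and init: "is_initial m f"
  shows "m \<notin> std_exponents A"
proof
  assume m: "m \<in> std_exponents A"
  show False
  proof (rule peval_standard_expansion[OF f], rule peval_standard_expansion[OF g])
    fix h h'
    assume h:
      "\<And>r. r \<in> paths \<Longrightarrow> peval (\<lambda>c. [:c:]) (path_point r) f = (\<Sum>s\<in>std_exponents A. h s * meval (path_point r) s)"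
      "\<And>m. is_initial m f \<Longrightarrow> m \<in> std_exponents A \<Longrightarrow> h m = [:lookup f m:]"
    assume h':
      "\<And>r. r \<in> paths \<Longrightarrow> peval (\<lambda>c. [:c:]) (path_point r) g = (\<Sum>s\<in>std_exponents A. h' s * meval (path_point r) s)"
    have hm: "h m = [:lookup f m:]" by (rule h(2)[OF init m])
    have "h m - [:0, 1:] * h' m = 0"
    proof (rule square_relation_trivial[where M = "\<lambda>s r. meval (path_point r) s" and S = "std_exponents A" and \<Phi> = paths])
      show "(\<Sum>s\<in>std_exponents A. (h s - [:0, 1:] * h' s) * meval (path_point r) s) = 0" if "r \<in> paths" for r
        using eq[OF that] h(1)[OF that] h'(1)[OF that]
        by (simp add: left_diff_distrib sum_subtractf sum_distrib_left mult.assoc del: mult_pCons_left)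
      fix r assume r: "r \<in> paths"
      obtain k where k: "\<forall>r'\<in>paths. meval (path_point r') (path_monomial r)
          = (\<Sum>s\<in>std_exponents A. k s * meval (path_point r') s)"
        using meval_standard_expansion[OF path_monomial_keys[OF r]] by blast
      show "\<exists>h d. d \<noteq> 0 \<and> (\<forall>r'\<in>paths. (\<Sum>s\<in>std_exponents A. h s * meval (path_point r') s) = (if r' = r then d else 0))"
        using k meval_path_monomial[OF r] r
        by (intro exI[of _ k] exI[of _ "meval (path_point r) (path_monomial r)"]) auto
    qed (use finite_std_exponents finite_lattice_paths card_std_exponents_le m in auto)
    \<comment> \<open>Comparing constant terms is setting \<epsilon> = 0, which kills the right-hand
      side.\<close>
    then have "coeff [:lookup f m:] 0 = coeff ([:0, 1:] * h' m) 0"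
      by (simp add: hm del: mult_pCons_left)
    then have "lookup f m = 0" by simp
    then show False using init by (simp add: is_initial_def in_keys_iff)
  qed
qed

end

section \<open>Standard monomials of the initial ideal\<close>

context lattice_region
begin

lemma S_set_eq: "S_set A p q = (\<lambda>m. single m 1) ` std_exponents A"
proof
  have inner: "A - ({(m, j_sharp A m) | m. m \<le> p} \<union> {(i_flat A m, m) | m. m \<le> q}) = inner_points A"
    using bounded by (auto simp: inner_points_def)
  have lookup_indicator: "lookup (\<Sum>v\<in>T. single v (1::nat)) u = (if u \<in> T then 1 else 0)"
    if "finite T" for T :: "(nat \<times> nat) set" and u
    using that by (simp add: lookup_sum lookup_single when_def)
  show "S_set A p q \<subseteq> (\<lambda>m. single m 1) ` std_exponents A"
  proof
    fix f assume "f \<in> S_set A p q"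
    then obtain r :: nat and i j where f: "f = (\<Prod>k=1..r. X (i k, j k))"
      and mem: "\<And>k. k \<in> {1..r} \<Longrightarrow> (i k, j k) \<in> inner_points A"
      and mono: "strict_mono_on {1..r} i" "strict_mono_on {1..r} j"
      unfolding S_set_def inner by blast
    let ?v = "\<lambda>k. (i k, j k)"
    define T where "T = ?v ` {1..r}"
    have below: "strictly_below (?v k) (?v l)" if "k \<in> {1..r}" "l \<in> {1..r}" "k < l" for k l
      using strict_mono_onD[OF mono(1) that] strict_mono_onD[OF mono(2) that] by (simp add: strictly_below_def)
    have inj: "inj_on ?v {1..r}"
    proof (rule inj_onI)
      fix k l assume "k \<in> {1..r}" "l \<in> {1..r}" "?v k = ?v l"
      then show "k = l"
        using below[of k l] below[of l k] by (cases k l rule: linorder_cases) (auto simp: strictly_below_def)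
    qed
    have "f = single (\<Sum>k=1..r. single (?v k) 1) 1"
      unfolding f X_def by (rule prod_single_one)
    also have "(\<Sum>k=1..r. single (?v k) (1::nat)) = (\<Sum>v\<in>T. single v 1)"
      unfolding T_def by (subst sum.reindex[OF inj]) simp
    finally have f': "f = single (\<Sum>v\<in>T. single v 1) 1" .
    have fin: "finite T" by (simp add: T_def)
    define m where "m = (\<Sum>v\<in>T. single v (1::nat))"
    have lookup: "lookup m u = (if u \<in> T then 1 else 0)" for u
      unfolding m_def by (rule lookup_indicator[OF fin])
    then have keys: "keys m = T" by (auto simp: in_keys_iff split: if_splits)
    have "strictly_below v w \<or> strictly_below w v" if "v \<in> T" "w \<in> T" "v \<noteq> w" for v w
    proof -
      from that obtain k l where kl: "k \<in> {1..r}" "l \<in> {1..r}" "v = ?v k" "w = ?v l" "k \<noteq> l"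
        unfolding T_def by blast
      then show ?thesis using below[of k l] below[of l k] by (cases "k < l") auto
    qed
    moreover have "T \<subseteq> inner_points A" using mem by (auto simp: T_def)
    ultimately have "m \<in> std_exponents A"
      by (simp add: std_exponents_def keys lookup)
    then show "f \<in> (\<lambda>m. single m 1) ` std_exponents A" using f' by (auto simp: m_def)
  qed
  show "(\<lambda>m. single m 1) ` std_exponents A \<subseteq> S_set A p q"
  proof
    fix f :: "(nat \<times> nat, ratfun) mpoly" assume "f \<in> (\<lambda>m. single m 1) ` std_exponents A"
    then obtain m where f: "f = single m 1" and m: "m \<in> std_exponents A" by blast
    have sub: "keys m \<subseteq> inner_points A" and one: "\<And>v. v \<in> keys m \<Longrightarrow> lookup m v = 1"
      and chain: "\<And>v w. v \<in> keys m \<Longrightarrow> w \<in> keys m \<Longrightarrow> v \<noteq> w \<Longrightarrow> strictly_below v w \<or> strictly_below w v"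
      using m unfolding std_exponents_def by blast+
    \<comment> \<open>On a chain for \<open>strictly_below\<close> the lexicographic order of pairs
      agrees with it, so sorting lists the factors with both coordinates increasing;
      \<open>k - 1\<close> converts indices from 1 to list positions from 0.\<close>
    define xs where "xs = sorted_list_of_set (keys m)"
    define r where "r = length xs"
    define v where "v k = xs ! (k - 1)" for k
    have set: "set xs = keys m" and dist: "distinct xs" and sorted: "sorted_wrt (<) xs"
      by (simp_all add: xs_def)
    have bij: "bij_betw v {1..r} (keys m)"
    proof -
      have "bij_betw (\<lambda>k. k - 1) {1..r} {..<length xs}"
        by (rule bij_betw_byWitness[where f' = Suc]) (auto simp: r_def)
      from bij_betw_trans[OF this bij_betw_nth[OF dist refl refl]] show ?thesis
        by (simp add: set v_def[abs_def] comp_def)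
    qed
    have mem: "v k \<in> keys m" if "k \<in> {1..r}" for k
      using bij that by (auto dest: bij_betwE)
    have below: "strictly_below (v k) (v l)" if "k \<in> {1..r}" "l \<in> {1..r}" "k < l" for k l
    proof -
      have less: "v k < v l"
        unfolding v_def using that by (intro sorted_wrt_nth_less[OF sorted]) (auto simp: r_def)
      then have "v k \<noteq> v l" by simp
      with less show ?thesis
        using chain[OF mem[OF that(1)] mem[OF that(2)]] by (auto simp: strictly_below_def less_prod_def')
    qed
    have "m = (\<Sum>u\<in>keys m. single u 1)"
    proof (rule poly_mapping_eqI)
      fix u
      show "lookup m u = lookup (\<Sum>u\<in>keys m. single u 1) u"
        unfolding lookup_indicator[OF finite_keys] using one
        by (simp add: not_in_keys_iff_lookup_eq_zero)
    qed
    then have "f = (\<Prod>u\<in>keys m. X u)"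
      unfolding f X_def by (subst prod_single_one) simp
    also have "\<dots> = (\<Prod>k=1..r. X (v k))"
      by (rule prod.reindex_bij_betw[OF bij, symmetric])
    finally have "f = (\<Prod>k=1..r. X (fst (v k), snd (v k)))" by simp
    moreover have "\<forall>k\<in>{1..r}. (fst (v k), snd (v k)) \<in> inner_points A \<and>
        0 < fst (v k) \<and> fst (v k) \<le> p \<and> 0 < snd (v k) \<and> snd (v k) \<le> q"
    proof
      fix k assume "k \<in> {1..r}"
      then have "(fst (v k), snd (v k)) \<in> inner_points A" using mem sub by auto
      then show "(fst (v k), snd (v k)) \<in> inner_points A \<and>
          0 < fst (v k) \<and> fst (v k) \<le> p \<and> 0 < snd (v k) \<and> snd (v k) \<le> q"
        using inner_points_neighbours(1-3)[of "fst (v k)" "snd (v k)"] bounded[of "fst (v k)" "snd (v k)"]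
        by blast
    qed
    moreover have "strict_mono_on {1..r} (\<lambda>k. fst (v k))" "strict_mono_on {1..r} (\<lambda>k. snd (v k))"
      using below by (auto simp: strict_mono_on_def strictly_below_def)
    ultimately show "f \<in> S_set A p q"
      unfolding S_set_def inner mem_Collect_eq
      by (intro exI[of _ r] exI[of _ "\<lambda>k. fst (v k)"] exI[of _ "\<lambda>k. snd (v k)"] conjI)
  qed
qed

end

section \<open>The ideal J at the path points\<close>

lemma theta_row_eq:
  "theta_row A \<eta> i = (\<Sum>v\<in>{v\<in>A. i \<le> fst v}. const (\<xi> v) * X v) - const (\<eta> i)"
  by (simp add: theta_row_def case_prod_unfold)

lemma theta_col_eq:
  "theta_col A \<eta> j = (\<Sum>v\<in>{v\<in>A. j \<le> snd v}. const (\<xi> v) * X v) - const (\<eta> j)"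
  by (simp add: theta_col_def case_prod_unfold)

context path_evaluation
begin

text \<open>The path points solve the perturbed system. The toric initial monomials vanish there by
  \<open>path_point_antidiagonal\<close>, and each \<theta> takes as its value \<epsilon> times its
  weight; both properties pass to the ideal generated.\<close>

lemma J_ideal_perturbation:
  assumes two_chain: "two_chain_poset P a b p q" and A: "A = index_set P a b p q"
    and f: "f \<in> J_ideal A a b p q \<eta>r \<eta>c"
  shows "f \<in> polys UNIV A \<and> (\<exists>g\<in>polys UNIV A. \<forall>r\<in>paths.
    peval (\<lambda>c. [:c:]) (path_point r) f = [:0, 1:] * peval (\<lambda>c. [:c:]) (path_point r) g)"
proof -
  interpret coeff_hom "\<lambda>c :: ratfun. [:c:]" by (rule coeff_hom_constant_poly)
  define Z where "Z = {f \<in> polys UNIV A. \<exists>g\<in>polys UNIV A. \<forall>r\<in>paths.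
    peval (\<lambda>c. [:c:]) (path_point r) f = [:0, 1:] * peval (\<lambda>c. [:c:]) (path_point r) g}"
  have ring: "is_subring (polys UNIV A :: (nat \<times> nat, ratfun) mpoly set)"
    by (intro is_subring_polys is_subring_UNIV)
  note ring' = ring[unfolded is_subring_def]
  have ZI: "f \<in> Z" if "f \<in> polys UNIV A" "g \<in> polys UNIV A"
    "\<And>r. r \<in> paths \<Longrightarrow> peval (\<lambda>c. [:c:]) (path_point r) f = [:0, 1:] * peval (\<lambda>c. [:c:]) (path_point r) g" for f g
    using that unfolding Z_def by blast
  have Kx_sub: "Kx A \<subseteq> polys UNIV A" by (auto simp: Kx_def polys_def)
  have ideal: "is_ideal (Kx A) Z"
    unfolding is_ideal_def
  proof (intro conjI ballI)
    show "0 \<in> Z" by (rule ZI[of _ 0]) (use ring' in auto)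
  next
    fix f f' assume "f \<in> Z" "f' \<in> Z"
    then obtain g g' where "f \<in> polys UNIV A" "f' \<in> polys UNIV A" "g \<in> polys UNIV A" "g' \<in> polys UNIV A"
      and eq: "\<And>r. r \<in> paths \<Longrightarrow> peval (\<lambda>c. [:c:]) (path_point r) f = [:0, 1:] * peval (\<lambda>c. [:c:]) (path_point r) g"
        "\<And>r. r \<in> paths \<Longrightarrow> peval (\<lambda>c. [:c:]) (path_point r) f' = [:0, 1:] * peval (\<lambda>c. [:c:]) (path_point r) g'"
      unfolding Z_def by blast
    then show "f + f' \<in> Z"
      using ring' by (intro ZI[of _ "g + g'"]) (simp_all only: peval_add eq distrib_left)
  next
    fix c f assume "c \<in> Kx A" "f \<in> Z"
    then obtain g where "c \<in> polys UNIV A" "f \<in> polys UNIV A" "g \<in> polys UNIV A"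
      and eq: "\<And>r. r \<in> paths \<Longrightarrow> peval (\<lambda>c. [:c:]) (path_point r) f = [:0, 1:] * peval (\<lambda>c. [:c:]) (path_point r) g"
      using Kx_sub unfolding Z_def by blast
    then show "c * f \<in> Z"
      using ring' by (intro ZI[of _ "c * g"]) (simp_all only: peval_mult eq mult.left_commute)
  qed
  have "initial_ideal A (toric_ideal A a b) \<subseteq> Z"
    unfolding initial_ideal_def
  proof (rule ideal_in_least[OF ideal], rule subsetI)
    fix h :: "(nat \<times> nat, ratfun) mpoly"
    assume "h \<in> {single m 1 | m. \<exists>f\<in>toric_ideal A a b. f \<noteq> 0 \<and> is_initial m f}"
    then obtain m f where h: "h = single m 1" and f: "f \<in> toric_ideal A a b" "is_initial m f" by blast
    obtain v w where vw: "v \<in> keys m" "w \<in> keys m" "antidiagonal v w"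
      using toric_initial_antidiagonal[OF two_chain A f] by blast
    have "keys m \<subseteq> A" using f by (auto simp: toric_ideal_def Kx_def polys_def is_initial_def)
    then have "h \<in> polys UNIV A" unfolding h by (intro single_in_polys) auto
    moreover have "peval (\<lambda>c. [:c:]) (path_point r) h = 0" if "r \<in> paths" for r
      using path_point_antidiagonal[OF that vw(3)] vw
        meval_eq_0[of v m "path_point r"] meval_eq_0[of w m "path_point r"]
      unfolding h peval_single by auto
    ultimately show "h \<in> Z" using ring' by (intro ZI[of _ 0]) auto
  qed
  moreover have lin: "(\<Sum>v\<in>U. const (\<xi> v) * X v) - const c \<in> polys UNIV A" if "U \<subseteq> A" for U c
    using that ring' by (intro is_subring_diff[OF ring] is_subring_sum[OF ring] const_in_polys is_subring_UNIV)
      (auto intro!: const_in_polys X_in_polys is_subring_UNIV)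
  have "theta_row A \<eta>r ` {0..p} \<subseteq> Z"
  proof (rule image_subsetI)
    fix i assume i: "i \<in> {0..p}"
    show "theta_row A \<eta>r i \<in> Z"
    \<comment> \<open>The perturbed form of row \<open>i\<close> vanishes, so \<theta> itself equals
      the added term, with weight \<open>Suc i\<close>.\<close>
    proof (rule ZI[of _ "const (of_nat (Suc i))"])
      fix r assume "r \<in> paths"
      then show "peval (\<lambda>c. [:c:]) (path_point r) (theta_row A \<eta>r i)
          = [:0, 1:] * peval (\<lambda>c. [:c:]) (path_point r) (const (of_nat (Suc i)))"
        using row_sum[of r i] i
        by (simp add: theta_row_eq peval_diff peval_sum peval_mult row_value_def del: mult_pCons_left of_nat_Suc)
    qed (auto simp: theta_row_eq intro!: lin const_in_polys is_subring_UNIV)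
  qed
  moreover have "theta_col A \<eta>c ` {0..q} \<subseteq> Z"
  proof (rule image_subsetI)
    fix j assume j: "j \<in> {0..q}"
    let ?w = "of_nat (if j = 0 then 1 else Suc (p + j)) :: ratfun"
    show "theta_col A \<eta>c j \<in> Z"
    proof (rule ZI[of _ "const ?w"])
      fix r assume "r \<in> paths"
      then show "peval (\<lambda>c. [:c:]) (path_point r) (theta_col A \<eta>c j)
          = [:0, 1:] * peval (\<lambda>c. [:c:]) (path_point r) (const ?w)"
        using col_sum[of r j] j
        by (simp add: theta_col_eq peval_diff peval_sum peval_mult col_value_def del: mult_pCons_left of_nat_Suc)
    qed (auto simp: theta_col_eq intro!: lin const_in_polys is_subring_UNIV)
  qed
  ultimately have "J_ideal A a b p q \<eta>r \<eta>c \<subseteq> Z"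
    unfolding J_ideal_def by (intro ideal_in_least[OF ideal]) blast
  then show ?thesis using f by (auto simp: Z_def)
qed

end

lemma monomial_in_monomial_ideal:
  assumes "single m 1 \<in> ideal_in R G" "G \<subseteq> range (\<lambda>n. single n (1 :: 'c::comm_ring_1))"
  shows "\<exists>n t. single n 1 \<in> G \<and> m = t + n"
proof -
  obtain F c where sum: "single m 1 = (\<Sum>g\<in>F. c g * g)" and F: "F \<subseteq> G"
    using assms(1) by (rule ideal_inE)
  have "m \<in> keys (\<Sum>g\<in>F. c g * g)" by (simp flip: sum)
  then obtain g where g: "g \<in> F" "m \<in> keys (c g * g)"
    using keys_sum_subset[of "\<lambda>g. c g * g" F] by blast
  then obtain n where n: "g = single n 1" using F assms(2) by blast
  from g(2) obtain t u where "m = t + u" "u \<in> keys g"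
    using Poly_Mapping.keys_mult[of "c g" g] by blast
  then show ?thesis using n g(1) F by auto
qed

lemma std_exponents_divisor: "t + n \<in> std_exponents A \<Longrightarrow> n \<in> std_exponents A"
proof -
  assume tn: "t + n \<in> std_exponents A"
  have "lookup n v = 1" if "v \<in> keys n" for v
  proof -
    have "lookup t v + lookup n v = 1"
      using tn that by (auto simp: std_exponents_def keys_add_nat lookup_add)
    then show ?thesis using that by (simp add: in_keys_iff)
  qed
  then show ?thesis using tn by (simp add: std_exponents_def keys_add_nat)
qed

theorem theorem3:
  fixes P :: "'a::order set" and a b :: "nat \<Rightarrow> 'a" and p q :: nat
    and A :: "(nat \<times> nat) set" and \<eta>r \<eta>c :: "nat \<Rightarrow> ratfun"
  assumes "p \<ge> 1" and "q \<ge> 1"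
    and "two_chain_poset P a b p q"
    and "A = index_set P a b p q"
    and "\<And>i. i \<le> p \<Longrightarrow> \<eta>r i \<in> ratfun_field A"
    and "\<And>j. j \<le> q \<Longrightarrow> \<eta>c j \<in> ratfun_field A"
    and "\<eta>r 0 = \<eta>c 0"
  shows "standard_monomials A (J_ideal A a b p q \<eta>r \<eta>c) = S_set A p q"
proof -
  interpret lattice_region A p q
    using assms(3,4) lattice_region_index_set by blast
  interpret path_evaluation A p q \<eta>r \<eta>c
    by unfold_locales (rule assms(7))
  define J where "J = J_ideal A a b p q \<eta>r \<eta>c"
  \<comment> \<open>Beyond \<open>p\<close> and \<open>q\<close> the forms have no variables; the
    constant 0 makes them the zero polynomial, which lies in \<open>J\<close>.\<close>
  define \<eta>r' \<eta>c' where "\<eta>r' i = (if i \<le> p then \<eta>r i else 0)" and "\<eta>c' j = (if j \<le> q then \<eta>c j else 0)" for i j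
  have J_ideal: "is_ideal (Kx A) J"
    unfolding J_def J_ideal_def by (rule ideal_in_is_ideal[OF is_subring_Kx])
  have generator: "g \<in> J" if "g \<in> initial_ideal A (toric_ideal A a b) \<union> theta_row A \<eta>r ` {0..p} \<union> theta_col A \<eta>c ` {0..q}" for g
    unfolding J_def J_ideal_def using that by (rule ideal_in_generator[OF is_subring_Kx])
  have zero: "0 \<in> J" using J_ideal by (simp add: is_ideal_def)
  interpret J: reduction A p q "ratfun_field A" \<xi> \<eta>r' \<eta>c' J
  proof unfold_locales
    show "is_subring (ratfun_field A)" by (rule is_subring_ratfun_field)
    show "\<xi> v \<in> ratfun_field A" if "v \<in> A" for v using that by (rule xi_in_ratfun_field)
    show "is_ideal (polys (ratfun_field A) A) J" using J_ideal by (simp add: Kx_def)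
    show "X v * X w \<in> J" if "v \<in> A" "w \<in> A" "antidiagonal v w" for v w
      using antidiagonal_in_initial_toric[OF assms(3,4) that] generator by blast
    show "(\<Sum>v\<in>{v\<in>A. i \<le> fst v}. const (\<xi> v) * X v) - const (\<eta>r' i) \<in> J" for i
    proof (cases "i \<le> p")
      case True
      then show ?thesis using generator[of "theta_row A \<eta>r i"] by (simp add: theta_row_eq \<eta>r'_def)
    next
      case False
      then have "{v\<in>A. i \<le> fst v} = {}" using bounded by fastforce
      then show ?thesis using zero False by (simp add: \<eta>r'_def const_def del: Collect_empty_eq)
    qed
    show "(\<Sum>v\<in>{v\<in>A. j \<le> snd v}. const (\<xi> v) * X v) - const (\<eta>c' j) \<in> J" for j
    proof (cases "j \<le> q")
      case True
      then show ?thesis using generator[of "theta_col A \<eta>c j"] by (simp add: theta_col_eq \<eta>c'_def)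
    next
      case False
      then have "{v\<in>A. j \<le> snd v} = {}" using bounded by fastforce
      then show ?thesis using zero False by (simp add: \<eta>c'_def const_def del: Collect_empty_eq)
    qed
  qed
  have nonstandard: "single m 1 \<in> initial_ideal A J" if m: "keys m \<subseteq> A" "m \<notin> std_exponents A" for m
  proof -
    obtain f v e where f: "f \<in> J" "f - single m (\<xi> v ^ e) \<in> lower_polys A m"
      using J.reducible_nonstandard[OF m] unfolding J.reducible_def by blast
    have lookup: "lookup f n = lookup (f - single m (\<xi> v ^ e)) n + lookup (single m (\<xi> v ^ e)) n" for n
      by (simp add: lookup_minus)
    have "m \<notin> keys (f - single m (\<xi> v ^ e))"
      using f(2) less_rev_irrefl by (auto simp: lower_polys_def)
    \<comment> \<open>A power of \<open>\<xi> v\<close> is nonzero, so the leading term is really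
      present and \<open>m\<close> is initial.\<close>
    then have "lookup f m = \<xi> v ^ e"
      using lookup[of m] by (simp add: in_keys_iff del: lookup_minus)
    then have "m \<in> keys f" using xi_nonzero by (simp add: in_keys_iff)
    moreover have "less_rev n m" if "n \<in> keys f" "n \<noteq> m" for n
      using that lookup[of n] f(2) by (simp add: lower_polys_def in_keys_iff lookup_single)
    ultimately have "is_initial m f" by (simp add: is_initial_def)
    from initial_ideal_generator[OF f(1) this] show ?thesis .
  qed
  have standard: "single m 1 \<notin> initial_ideal A J" if m: "m \<in> std_exponents A" for m
  proof
    assume "single m 1 \<in> initial_ideal A J"
    then obtain n t where "single n (1 :: ratfun) \<in> {single m 1 | m. \<exists>f\<in>J. f \<noteq> 0 \<and> is_initial m f}"
      and mn: "m = t + n"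
      using monomial_in_monomial_ideal[of m "Kx A"] unfolding initial_ideal_def by blast
    then obtain n' f where n': "single n (1 :: ratfun) = single n' 1" and f: "f \<in> J" "is_initial n' f"
      by blast
    have "n' = n" using arg_cong[OF n', of keys] by simp
    have fJ: "f \<in> J_ideal A a b p q \<eta>r \<eta>c" using f(1) by (simp add: J_def)
    have "n' \<notin> std_exponents A"
      using J_ideal_perturbation[OF assms(3,4) fJ] no_standard_initial f(2) by blast
    then show False
      using std_exponents_divisor[of t n A] m mn \<open>n' = n\<close> by simp
  qed
  have "std_exponents A \<subseteq> {m. keys m \<subseteq> A}"
    by (auto simp: std_exponents_def inner_points_def)
  then show ?thesis
    unfolding standard_monomials_def S_set_eq monomials_def J_def[symmetric]
    using nonstandard standard by blast
qed

end
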